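(* There is an absolute constant $K>0$ such that the following holds for every $\epsilon\in(0,1)$. Let $P(X)=\sum_{i=1}^mA_i(X)B_i(X)$ be a polynomial in $X=(X_1,\dots,X_n)$, where each $A_i,B_i$ is a quadratic form with $0\preceq A_i\preceq\|X\|^2$, $B_i\succeq0$ and $\sum_iB_i\preceq\|X\|^2$. Let $\|P\|=\max_{\|x\|=1}|P(x)|$ and $d\ge K\log n/\epsilon^2$. (1) Every level-$d$ pseudoexpectation $\tilde{\mathbb{E}}$ over $X$ satisfying $\tilde{\mathbb{E}}[(\|X\|^2-1)Q]=0$ for all polynomials $Q$ of degree at most $d-2$ has $\tilde{\mathbb{E}}P(X)\le3\|P\|+\epsilon$. (2) If moreover $X=(Y,Z)$ with the $A_i$ depending only on $Y$ and the $B_i$ depending only on $Z$, then every level-$d$ pseudoexpectation $\tilde{\mathbb{E}}$ satisfying $\tilde{\mathbb{E}}[(\|Y\|^2-\tfrac12)Q]=\tilde{\mathbb{E}}[(\|Z\|^2-\tfrac12)Q]=0$ for all polynomials $Q$ of degree at most $d-2$ has $\tilde{\mathbb{E}}P(X)\le\|P\|+\epsilon$.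
   Context: $\|x\|$ is the Euclidean norm. For polynomials $P,Q$, $P\preceq Q$ means $Q-P$ is a sum of squares of polynomials; for quadratic forms this is equivalent to the corresponding symmetric matrices satisfying the PSD (Loewner) order, so e.g. $A_i\preceq\|X\|^2$ means the matrix of $A_i$ is $\preceq I$. A level-$d$ pseudoexpectation over $X$ is a linear functional on real polynomials of degree at most $d$ in $X$ with $\tilde{\mathbb{E}}1=1$ and $\tilde{\mathbb{E}}Q^2\ge0$ whenever $\deg Q\le d/2$. *)

theory Defs
  imports Complex_Main
begin

text \<open>Points of R^n are functions x :: nat => real; only coordinates i < n matter.
Real polynomials in X_0..X_(n-1) are represented by the polynomial functions they
induce (a bijective correspondence over the reals).\<close>

definition monom :: "nat \<Rightarrow> (nat \<Rightarrow> nat) \<Rightarrow> (nat \<Rightarrow> real) \<Rightarrow> real" where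
  "monom n \<alpha> x = (\<Prod>i<n. x i ^ \<alpha> i)"

definition exps :: "nat \<Rightarrow> nat \<Rightarrow> (nat \<Rightarrow> nat) set" where
  "exps n d = {\<alpha>. (\<forall>i\<ge>n. \<alpha> i = 0) \<and> (\<Sum>i<n. \<alpha> i) \<le> d}"

definition polys :: "nat \<Rightarrow> nat \<Rightarrow> ((nat \<Rightarrow> real) \<Rightarrow> real) set" where
  "polys n d = {f. \<exists>S c. finite S \<and> S \<subseteq> exps n d \<and>
                        f = (\<lambda>x. \<Sum>\<alpha>\<in>S. c \<alpha> * monom n \<alpha> x)}"

definition pseudoexp :: "nat \<Rightarrow> nat \<Rightarrow> (((nat \<Rightarrow> real) \<Rightarrow> real) \<Rightarrow> real) \<Rightarrow> bool" where
  "pseudoexp n d E \<longleftrightarrow>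
     (\<forall>f\<in>polys n d. \<forall>g\<in>polys n d. \<forall>a b::real.
         E (\<lambda>x. a * f x + b * g x) = a * E f + b * E g) \<and>
     E (\<lambda>x. 1) = 1 \<and>
     (\<forall>Q\<in>polys n (d div 2). E (\<lambda>x. (Q x)\<^sup>2) \<ge> 0)"

definition qf :: "nat \<Rightarrow> (nat \<Rightarrow> nat \<Rightarrow> real) \<Rightarrow> (nat \<Rightarrow> real) \<Rightarrow> real" where
  "qf n M x = (\<Sum>i<n. \<Sum>j<n. M i j * x i * x j)"

definition sqnorm :: "nat \<Rightarrow> (nat \<Rightarrow> real) \<Rightarrow> real" where
  "sqnorm n x = (\<Sum>i<n. (x i)\<^sup>2)"

definition symmetric_mat :: "nat \<Rightarrow> (nat \<Rightarrow> nat \<Rightarrow> real) \<Rightarrow> bool" where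
  "symmetric_mat n M \<longleftrightarrow> (\<forall>i<n. \<forall>j<n. M i j = M j i)"

definition Ppoly :: "nat \<Rightarrow> nat \<Rightarrow> (nat \<Rightarrow> nat \<Rightarrow> nat \<Rightarrow> real) \<Rightarrow> (nat \<Rightarrow> nat \<Rightarrow> nat \<Rightarrow> real)
                     \<Rightarrow> (nat \<Rightarrow> real) \<Rightarrow> real" where
  "Ppoly n m A B x = (\<Sum>k<m. qf n (A k) x * qf n (B k) x)"

definition polynorm :: "nat \<Rightarrow> ((nat \<Rightarrow> real) \<Rightarrow> real) \<Rightarrow> real" where
  "polynorm n P = Sup {\<bar>P x\<bar> | x. sqnorm n x = 1}"

end

theory Submission
  imports Defs
begin

text \<open>Write \<open>\<rho>\<close> for the second moment matrix of a pseudoexpectation; it is a density matrix. After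
  adding a remainder form, \<open>\<Sum>\<^sub>i B\<^sub>i = \<parallel>X\<parallel>\<^sup>2\<close>, so conditioning on a random \<open>B\<^sub>i\<close> (drawn with
  probability \<open>\<rho>(B\<^sub>i)\<close>) preserves \<open>\<rho>\<close> and the expectation of \<open>P\<close> on average. The difference between
  the expectation of \<open>P\<close> and \<open>\<beta> = \<Sum>\<^sub>i \<rho>(A\<^sub>i) \<rho>(B\<^sub>i)\<close> is the average change of \<open>\<rho>(A\<^sub>i)\<close> under
  this conditioning. As \<open>0 \<le> A\<^sub>i \<le> 1\<close>, a change of size \<open>\<epsilon>\<close> increases the squared norm of
  \<open>\<rho>\<close> dual to the Schatten \<open>p\<close>-norm, \<open>p \<approx> ln n\<close>, by about \<open>\<epsilon>\<^sup>2 / p\<close>, because the Schatten norm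
  is 2-smooth with constant \<open>p - 1\<close>. This quantity lies in \<open>[0, 1]\<close>, so after \<open>O(ln n / \<epsilon>\<^sup>2)\<close>
  rounds the change must have been small. Finally \<open>\<beta> \<le> 3 \<parallel>P\<parallel>\<close> follows by evaluating \<open>P\<close> at a
  Gaussian vector with covariance \<open>\<rho>\<close>, and \<open>\<beta> \<le> \<parallel>P\<parallel>\<close> in the bipartite case by homogeneity in
  each block.\<close>

subsection \<open>Polynomial functions\<close>

lemma finite_exps: "finite (exps n d)"
proof (rule finite_subset)
  show "exps n d \<subseteq> {\<alpha>. \<forall>i. (i \<in> {..<n} \<longrightarrow> \<alpha> i \<in> {..d}) \<and> (i \<notin> {..<n} \<longrightarrow> \<alpha> i = 0)}"
  proof
    fix \<alpha> assume a: "\<alpha> \<in> exps n d"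
    have "\<alpha> i \<le> d" if "i < n" for i
      using a member_le_sum[of i "{..<n}" \<alpha>] that by (auto simp: exps_def)
    then show "\<alpha> \<in> {\<alpha>. \<forall>i. (i \<in> {..<n} \<longrightarrow> \<alpha> i \<in> {..d}) \<and> (i \<notin> {..<n} \<longrightarrow> \<alpha> i = 0)}"
      using a by (auto simp: exps_def)
  qed
qed (rule finite_set_of_finite_funs; simp)

text \<open>Padding coefficients with zeros gives all polynomials of degree at most \<open>d\<close>
  the same finite index set, so sums can be formed coefficientwise.\<close>

lemma polys_iff: "f \<in> polys n d \<longleftrightarrow> (\<exists>c. f = (\<lambda>x. \<Sum>\<alpha>\<in>exps n d. c \<alpha> * monom n \<alpha> x))"
proof
  assume "f \<in> polys n d"
  then obtain S c where S: "finite S" "S \<subseteq> exps n d"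
    and f: "f = (\<lambda>x. \<Sum>\<alpha>\<in>S. c \<alpha> * monom n \<alpha> x)"
    by (auto simp: polys_def)
  have "f = (\<lambda>x. \<Sum>\<alpha>\<in>exps n d. (if \<alpha> \<in> S then c \<alpha> else 0) * monom n \<alpha> x)"
    unfolding f using S finite_exps
    by (intro ext sum.mono_neutral_cong_left) auto
  then show "\<exists>c. f = (\<lambda>x. \<Sum>\<alpha>\<in>exps n d. c \<alpha> * monom n \<alpha> x)"
    by (rule exI[where x = "\<lambda>\<alpha>. if \<alpha> \<in> S then c \<alpha> else 0"])
qed (use finite_exps in \<open>auto simp: polys_def\<close>)

lemma polys_add:
  assumes "f \<in> polys n d" "g \<in> polys n d"
  shows "(\<lambda>x. f x + g x) \<in> polys n d"
proof -
  obtain a b where "f = (\<lambda>x. \<Sum>\<alpha>\<in>exps n d. a \<alpha> * monom n \<alpha> x)"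
    "g = (\<lambda>x. \<Sum>\<alpha>\<in>exps n d. b \<alpha> * monom n \<alpha> x)"
    using assms by (auto simp: polys_iff)
  then have "(\<lambda>x. f x + g x) = (\<lambda>x. \<Sum>\<alpha>\<in>exps n d. (a \<alpha> + b \<alpha>) * monom n \<alpha> x)"
    by (simp add: sum.distrib ring_distribs)
  then show ?thesis unfolding polys_iff by (intro exI)
qed

lemma polys_cmult:
  assumes "f \<in> polys n d"
  shows "(\<lambda>x. c * f x) \<in> polys n d"
proof -
  obtain a where "f = (\<lambda>x. \<Sum>\<alpha>\<in>exps n d. a \<alpha> * monom n \<alpha> x)"
    using assms by (auto simp: polys_iff)
  then have "(\<lambda>x. c * f x) = (\<lambda>x. \<Sum>\<alpha>\<in>exps n d. (c * a \<alpha>) * monom n \<alpha> x)"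
    by (simp add: sum_distrib_left mult.assoc)
  then show ?thesis unfolding polys_iff by (intro exI)
qed

lemma polys_monom:
  assumes "\<alpha> \<in> exps n d"
  shows "monom n \<alpha> \<in> polys n d"
  using assms unfolding polys_def
  by (auto intro!: exI[of _ "{\<alpha>}"] exI[of _ "\<lambda>_. 1"])

lemma polys_const: "(\<lambda>x. c) \<in> polys n d"
proof -
  have "monom n (\<lambda>_. 0) \<in> polys n d"
    by (rule polys_monom) (simp add: exps_def)
  then show ?thesis
    using polys_cmult[of "monom n (\<lambda>_. 0)" n d c] by (simp add: monom_def)
qed

lemma polys_coord:
  assumes "i < n"
  shows "(\<lambda>x. x i) \<in> polys n 1"
proof -
  have "monom n (\<lambda>j. if j = i then 1 else 0) \<in> polys n 1"
    using assms by (intro polys_monom) (auto simp: exps_def)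
  moreover have "monom n (\<lambda>j. if j = i then 1 else 0) = (\<lambda>x. x i)"
  proof
    fix x
    have "monom n (\<lambda>j. if j = i then 1 else 0) x = (\<Prod>j<n. if j = i then x j else 1)"
      unfolding monom_def by (rule prod.cong) auto
    then show "monom n (\<lambda>j. if j = i then 1 else 0) x = x i"
      using assms by simp
  qed
  ultimately show ?thesis by simp
qed

lemma polys_diff:
  assumes "f \<in> polys n d" "g \<in> polys n d"
  shows "(\<lambda>x. f x - g x) \<in> polys n d"
  using polys_add[OF assms(1) polys_cmult[OF assms(2), of "-1"]] by simp

lemma polys_sum:
  assumes "\<And>i. i \<in> I \<Longrightarrow> f i \<in> polys n d"
  shows "(\<lambda>x. \<Sum>i\<in>I. f i x) \<in> polys n d"
  using assms
proof (induction I rule: infinite_finite_induct)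
  case (insert i I)
  then show ?case using polys_add[of "f i" n d "\<lambda>x. \<Sum>i\<in>I. f i x"] by simp
qed (simp_all add: polys_const)

lemma polys_mono:
  assumes "f \<in> polys n d" "d \<le> e"
  shows "f \<in> polys n e"
proof -
  have "exps n d \<subseteq> exps n e" using assms(2) by (auto simp: exps_def)
  then show ?thesis using assms(1) unfolding polys_def by fast
qed

lemma polys_mult:
  assumes "f \<in> polys n d" "g \<in> polys n e" "d + e \<le> k"
  shows "(\<lambda>x. f x * g x) \<in> polys n k"
proof -
  obtain a b where f: "f = (\<lambda>x. \<Sum>\<alpha>\<in>exps n d. a \<alpha> * monom n \<alpha> x)"
    and g: "g = (\<lambda>x. \<Sum>\<beta>\<in>exps n e. b \<beta> * monom n \<beta> x)"
    using assms by (auto simp: polys_iff)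
  have *: "(\<lambda>x. a \<alpha> * monom n \<alpha> x * (b \<beta> * monom n \<beta> x)) \<in> polys n k"
    if "\<alpha> \<in> exps n d" "\<beta> \<in> exps n e" for \<alpha> \<beta>
  proof -
    have "(\<lambda>i. \<alpha> i + \<beta> i) \<in> exps n k"
      using that assms(3) by (auto simp: exps_def sum.distrib)
    from polys_cmult[OF polys_monom[OF this], of "a \<alpha> * b \<beta>"]
    show ?thesis by (simp add: monom_def power_add prod.distrib mult_ac)
  qed
  show ?thesis
    unfolding f g sum_product by (intro polys_sum *)
qed

lemma polys_power2:
  assumes "f \<in> polys n d" "2 * d \<le> e"
  shows "(\<lambda>x. (f x)\<^sup>2) \<in> polys n e"
  using polys_mult[OF assms(1) assms(1), of e] assms(2) by (simp add: power2_eq_square)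

lemma polys_linear: "(\<lambda>x. \<Sum>i<n. u i * x i) \<in> polys n 1"
  by (intro polys_sum polys_cmult polys_coord) auto

lemma polys_coord2:
  assumes "i < n" "j < n"
  shows "(\<lambda>x. x i * x j) \<in> polys n 2"
  using polys_mult[OF polys_coord[OF assms(1)] polys_coord[OF assms(2)], of 2] by simp

lemma polys_qf: "qf n M \<in> polys n 2"
proof -
  have "(\<lambda>x. \<Sum>i<n. \<Sum>j<n. M i j * (x i * x j)) \<in> polys n 2"
    by (intro polys_sum polys_cmult polys_coord2) auto
  then show ?thesis by (simp add: qf_def[abs_def] mult.assoc)
qed

lemma polys_sqnorm: "sqnorm n \<in> polys n 2"
proof -
  have "(\<lambda>x. \<Sum>i<n. x i * x i) \<in> polys n 2"
    by (intro polys_sum polys_coord2) auto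
  then show ?thesis by (simp add: sqnorm_def[abs_def] power2_eq_square)
qed

lemma polys_Ppoly: "Ppoly n m A B \<in> polys n 4"
  unfolding Ppoly_def[abs_def]
  by (intro polys_sum polys_mult[OF polys_qf polys_qf]) auto

subsection \<open>Pseudoexpectations\<close>

lemma pseudoexp_lin:
  assumes "pseudoexp n d E" "f \<in> polys n d" "g \<in> polys n d"
  shows "E (\<lambda>x. a * f x + b * g x) = a * E f + b * E g"
  using assms by (auto simp: pseudoexp_def)

lemma pseudoexp_one: "pseudoexp n d E \<Longrightarrow> E (\<lambda>x. 1) = 1"
  by (simp add: pseudoexp_def)

lemma pseudoexp_square:
  assumes "pseudoexp n d E" "Q \<in> polys n k" "2 * k \<le> d"
  shows "E (\<lambda>x. (Q x)\<^sup>2) \<ge> 0"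
  using assms polys_mono[OF assms(2), of "d div 2"] by (auto simp: pseudoexp_def)

lemma pseudoexp_cmult:
  assumes "pseudoexp n d E" "f \<in> polys n d"
  shows "E (\<lambda>x. a * f x) = a * E f"
  using pseudoexp_lin[OF assms assms(2), of a 0] by simp

lemma pseudoexp_add:
  assumes "pseudoexp n d E" "f \<in> polys n d" "g \<in> polys n d"
  shows "E (\<lambda>x. f x + g x) = E f + E g"
  using pseudoexp_lin[OF assms, of 1 1] by simp

lemma pseudoexp_diff:
  assumes "pseudoexp n d E" "f \<in> polys n d" "g \<in> polys n d"
  shows "E (\<lambda>x. f x - g x) = E f - E g"
  using pseudoexp_lin[OF assms, of 1 "-1"] by simp

lemma pseudoexp_sum:
  assumes "pseudoexp n d E" "\<And>i. i \<in> I \<Longrightarrow> f i \<in> polys n d"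
  shows "E (\<lambda>x. \<Sum>i\<in>I. f i x) = (\<Sum>i\<in>I. E (f i))"
  using assms(2)
proof (induction I rule: infinite_finite_induct)
  case (insert i I)
  then show ?case
    using pseudoexp_add[OF assms(1), of "f i" "\<lambda>x. \<Sum>i\<in>I. f i x"] polys_sum[of I f n d] by simp
qed (use pseudoexp_cmult[OF assms(1) polys_const[of 0], of 0] in simp_all)

lemma pseudoexp_antimono:
  assumes "pseudoexp n d E" "e \<le> d"
  shows "pseudoexp n e E"
proof -
  have "f \<in> polys n d" if "f \<in> polys n e" for f
    using polys_mono[OF that assms(2)] .
  moreover have "f \<in> polys n (d div 2)" if "f \<in> polys n (e div 2)" for f
    using polys_mono[OF that] assms(2) by (simp add: div_le_mono)
  ultimately show ?thesis using assms(1) unfolding pseudoexp_def by blast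
qed

text \<open>The degenerate case of Cauchy-Schwarz: when the expectation of \<open>f^2\<close> is
  zero, that of \<open>(s f + g)^2\<close> is affine in \<open>s\<close> and nonnegative for all
  real \<open>s\<close>, so its slope vanishes.\<close>

lemma pseudoexp_null:
  assumes E: "pseudoexp n d E" and f: "f \<in> polys n k" "2 * k \<le> d" and g: "g \<in> polys n k"
    and null: "E (\<lambda>x. (f x)\<^sup>2) = 0"
  shows "E (\<lambda>x. f x * g x) = 0"
proof -
  have fg: "(\<lambda>x. f x * g x) \<in> polys n d" and f2: "(\<lambda>x. (f x)\<^sup>2) \<in> polys n d"
    and g2: "(\<lambda>x. (g x)\<^sup>2) \<in> polys n d"
    using polys_mult[OF f(1) g, of d] polys_power2[OF f(1), of d] polys_power2[OF g, of d] f(2)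
    by auto
  define b where "b = E (\<lambda>x. f x * g x)"
  define c where "c = E (\<lambda>x. (g x)\<^sup>2)"
  have *: "0 \<le> 2 * s * b + c" for s
  proof -
    have "0 \<le> E (\<lambda>x. (s * f x + g x)\<^sup>2)"
      by (intro pseudoexp_square[OF E _ f(2)] polys_add polys_cmult f g)
    also have "(\<lambda>x. (s * f x + g x)\<^sup>2) = (\<lambda>x. s\<^sup>2 * (f x)\<^sup>2 + 1 * (2 * s * (f x * g x) + 1 * (g x)\<^sup>2))"
      by (simp add: power2_eq_square algebra_simps)
    also have "E \<dots> = s\<^sup>2 * E (\<lambda>x. (f x)\<^sup>2) + 1 * E (\<lambda>x. 2 * s * (f x * g x) + 1 * (g x)\<^sup>2)"
      by (intro pseudoexp_lin[OF E] f2 polys_add polys_cmult fg g2)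
    also have "E (\<lambda>x. 2 * s * (f x * g x) + 1 * (g x)\<^sup>2) = 2 * s * b + 1 * c"
      unfolding b_def c_def by (intro pseudoexp_lin[OF E] fg g2)
    finally show ?thesis using null by simp
  qed
  have "b = 0"
  proof (rule ccontr)
    assume "b \<noteq> 0"
    \<comment> \<open>This \<open>s\<close> makes \<open>2 * s * b + c\<close> equal to -1.\<close>
    then show False using *[of "- (c + 1) / (2 * b)"] by (simp add: field_simps)
  qed
  then show ?thesis by (simp add: b_def)
qed

lemma pseudoexp_qf:
  assumes E: "pseudoexp n d E" "2 \<le> d"
  shows "E (qf n M) = (\<Sum>i<n. \<Sum>j<n. M i j * E (\<lambda>x. x i * x j))"
proof -
  have p: "(\<lambda>x. x i * x j) \<in> polys n d" if "i < n" "j < n" for i j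
    using polys_mono[OF polys_coord2[OF that] E(2)] .
  have "E (qf n M) = E (\<lambda>x. \<Sum>i<n. \<Sum>j<n. M i j * (x i * x j))"
    by (simp add: qf_def[abs_def] mult.assoc)
  also have "\<dots> = (\<Sum>i<n. E (\<lambda>x. \<Sum>j<n. M i j * (x i * x j)))"
    by (intro pseudoexp_sum[OF E(1)] polys_sum polys_cmult p) auto
  also have "\<dots> = (\<Sum>i<n. \<Sum>j<n. M i j * E (\<lambda>x. x i * x j))"
    by (intro sum.cong refl, subst pseudoexp_sum[OF E(1)])
      (auto intro!: polys_cmult p sum.cong pseudoexp_cmult[OF E(1)])
  finally show ?thesis .
qed

subsection \<open>Positive semidefinite forms\<close>

lemma qf_add: "qf n (\<lambda>i j. M i j + N i j) x = qf n M x + qf n N x"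
  by (simp add: qf_def algebra_simps sum.distrib)

lemma qf_cmult: "qf n (\<lambda>i j. c * M i j) x = c * qf n M x"
  by (simp add: qf_def sum_distrib_left mult.assoc)

lemma qf_cong: "(\<And>i j. i < n \<Longrightarrow> j < n \<Longrightarrow> M i j = N i j) \<Longrightarrow> qf n M x = qf n N x"
  by (simp add: qf_def)

text \<open>Cholesky decomposition by induction on the dimension: split off the last coordinate and
  pass to the Schur complement. It turns positivity of a form into an explicit sum of squares, which
  pseudoexpectations can use.\<close>

lemma psd_gram:
  assumes "symmetric_mat n M" "\<And>x. 0 \<le> qf n M x"
  shows "\<exists>v. \<forall>i<n. \<forall>j<n. M i j = (\<Sum>l<n. v l i * v l j)"
  using assms
proof (induction n arbitrary: M)
  case (Suc n)
  have sym: "M i j = M j i" if "i \<le> n" "j \<le> n" for i j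
    using Suc.prems(1) that by (simp add: symmetric_mat_def less_Suc_eq_le)
  have expand: "qf (Suc n) M x = qf n M x + 2 * x n * (\<Sum>i<n. M i n * x i) + M n n * (x n)\<^sup>2" for x
  proof -
    have "(\<Sum>j<n. M n j * x n * x j) = x n * (\<Sum>i<n. M i n * x i)"
      unfolding sum_distrib_left using sym by (intro sum.cong) auto
    moreover have "(\<Sum>i<n. M i n * x i * x n) = x n * (\<Sum>i<n. M i n * x i)"
      by (simp add: sum_distrib_left mult_ac)
    ultimately show ?thesis
      by (simp add: qf_def sum.distrib power2_eq_square)
  qed
  have quad: "0 \<le> qf n M x + 2 * z * (\<Sum>i<n. M i n * x i) + M n n * z\<^sup>2" for x z
  proof -
    have "qf n M (x(n := z)) = qf n M x" "(\<Sum>i<n. M i n * (x(n := z)) i) = (\<Sum>i<n. M i n * x i)"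
      by (auto simp: qf_def intro!: sum.cong)
    then show ?thesis using expand[of "x(n := z)"] Suc.prems(2)[of "x(n := z)"]
      by (simp only: fun_upd_same)
  qed
  show ?case
  proof (cases "M n n = 0")
    case True
    \<comment> \<open>A zero diagonal entry forces its column to vanish: otherwise the form would be
      affine and nonconstant in the last coordinate, hence unbounded below.\<close>
    have zero: "M i n = 0" if "i < n" for i
    proof (rule ccontr)
      assume nz: "M i n \<noteq> 0"
      define x where "x = (\<lambda>j. if j = i then 1 else 0 :: real)"
      have "(\<Sum>j<n. M j n * x j) = M i n"
        using that by (simp add: x_def if_distrib cong: if_cong)
      then show False
        using quad[of x "- (qf n M x + 1) / (2 * M i n)"] True nz by (simp add: field_simps)
    qed
    have "0 \<le> qf n M x" for x
      using quad[of x 0] by simp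
    moreover have "symmetric_mat n M" using sym by (simp add: symmetric_mat_def)
    ultimately obtain v where v: "\<forall>i<n. \<forall>j<n. M i j = (\<Sum>l<n. v l i * v l j)"
      using Suc.IH by blast
    \<comment> \<open>The induction hypothesis does not control \<open>v\<close> at index
      \<open>n\<close>, so it is cut off there.\<close>
    define w where "w = (\<lambda>l i. if l < n \<and> i < n then v l i else 0)"
    have "M i j = (\<Sum>l<Suc n. w l i * w l j)" if "i < Suc n" "j < Suc n" for i j
      using v that zero sym[of n j] True by (auto simp: w_def less_Suc_eq)
    then show ?thesis by blast
  next
    case False
    have "0 \<le> M n n" using quad[of "\<lambda>_. 0" 1] by (simp add: qf_def)
    with False have pos: "0 < M n n" by simp
    \<comment> \<open>The Schur complement: its form is the minimum of the form of \<open>M\<close>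
      over the last coordinate, attained at \<open>- s / M n n\<close>.\<close>
    define N where "N = (\<lambda>i j. M i j - M i n * M j n / M n n)"
    have "0 \<le> qf n N x" for x
    proof -
      define s where "s = (\<Sum>i<n. M i n * x i)"
      have "qf n N x = qf n M x - (\<Sum>i<n. \<Sum>j<n. (M i n * x i) * (M j n * x j)) / M n n"
        by (simp add: N_def qf_def algebra_simps sum_subtractf sum_divide_distrib)
      also have "(\<Sum>i<n. \<Sum>j<n. (M i n * x i) * (M j n * x j)) = s\<^sup>2"
        by (simp add: s_def power2_eq_square sum_product)
      finally have "qf n N x = qf n M x - s\<^sup>2 / M n n" .
      moreover have "2 * (- s / M n n) * s + M n n * (- s / M n n)\<^sup>2 = - (s\<^sup>2 / M n n)"
        using pos by (simp add: power2_eq_square field_simps)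
      moreover have "0 \<le> qf n M x + 2 * (- s / M n n) * s + M n n * (- s / M n n)\<^sup>2"
        using quad[of x "- s / M n n"] by (simp only: s_def)
      ultimately show ?thesis by linarith
    qed
    moreover have "symmetric_mat n N" using sym by (simp add: symmetric_mat_def N_def)
    ultimately obtain v where v: "\<forall>i<n. \<forall>j<n. N i j = (\<Sum>l<n. v l i * v l j)"
      using Suc.IH by blast
    define w where "w = (\<lambda>l i. if l < n then (if i < n then v l i else 0) else M i n / sqrt (M n n))"
    have "M i j = (\<Sum>l<Suc n. w l i * w l j)" if "i < Suc n" "j < Suc n" for i j
    proof -
      have "w n i * w n j = M i n * M j n / M n n"
        using pos by (simp add: w_def)
      moreover have "(\<Sum>l<n. w l i * w l j) = M i j - M i n * M j n / M n n"
      proof (cases "i < n \<and> j < n")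
        case True
        then show ?thesis using v by (simp add: w_def N_def)
      next
        case False
        then show ?thesis using that sym[of n j] pos by (auto simp: w_def less_Suc_eq)
      qed
      ultimately show ?thesis by simp
    qed
    then show ?thesis by blast
  qed
qed simp

lemma gram_qf:
  assumes "\<forall>i<n. \<forall>j<n. M i j = (\<Sum>l<r. v l i * v l j)"
  shows "qf n M x = (\<Sum>l<r. (\<Sum>i<n. v l i * x i)\<^sup>2)"
proof -
  have "qf n M x = (\<Sum>i<n. \<Sum>j<n. \<Sum>l<r. (v l i * x i) * (v l j * x j))"
    unfolding qf_def using assms
    by (intro sum.cong refl) (simp add: sum_distrib_left mult_ac)
  also have "\<dots> = (\<Sum>l<r. \<Sum>i<n. \<Sum>j<n. (v l i * x i) * (v l j * x j))"
    by (subst (2) sum.swap) (subst sum.swap, simp)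
  finally show ?thesis by (simp add: power2_eq_square sum_product)
qed

text \<open>On quadratic forms, a pseudoexpectation is a genuine finite (weighted) expectation.\<close>

lemma pseudoexp_qf_gram:
  assumes E: "pseudoexp n d E" "2 \<le> d"
  obtains v where "\<And>M. E (qf n M) = (\<Sum>l<n. qf n M (v l))"
proof -
  define R where "R = (\<lambda>i j. E (\<lambda>x. x i * x j))"
  have "symmetric_mat n R"
    by (simp add: symmetric_mat_def R_def mult.commute)
  moreover have "0 \<le> qf n R u" for u
  proof -
    have "(\<lambda>x. (\<Sum>i<n. u i * x i)\<^sup>2) = qf n (\<lambda>i j. u i * u j)"
      by (simp add: fun_eq_iff qf_def power2_eq_square sum_product mult_ac)
    moreover have "0 \<le> E (\<lambda>x. (\<Sum>i<n. u i * x i)\<^sup>2)"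
      using pseudoexp_square[OF E(1) polys_linear] E(2) by simp
    ultimately have "0 \<le> (\<Sum>i<n. \<Sum>j<n. u i * u j * R i j)"
      using pseudoexp_qf[OF E, of "\<lambda>i j. u i * u j"] by (simp add: R_def)
    then show ?thesis by (simp add: qf_def mult_ac)
  qed
  ultimately obtain v where v: "\<forall>i<n. \<forall>j<n. R i j = (\<Sum>l<n. v l i * v l j)"
    using psd_gram by blast
  have "E (qf n M) = (\<Sum>l<n. qf n M (v l))" for M
  proof -
    have "E (qf n M) = (\<Sum>i<n. \<Sum>j<n. \<Sum>l<n. M i j * v l i * v l j)"
      unfolding pseudoexp_qf[OF E]
      by (intro sum.cong refl, subst v[unfolded R_def, rule_format])
        (simp_all add: sum_distrib_left mult.assoc)
    also have "\<dots> = (\<Sum>l<n. qf n M (v l))"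
      unfolding qf_def by (subst (2) sum.swap) (subst sum.swap, simp)
    finally show ?thesis .
  qed
  then show ?thesis using that by blast
qed

subsection \<open>Traces of words in symmetric matrices\<close>

type_synonym rmat = "nat \<Rightarrow> nat \<Rightarrow> real"

definition mat_mult :: "nat \<Rightarrow> rmat \<Rightarrow> rmat \<Rightarrow> rmat" where
  "mat_mult n M N i j = (\<Sum>k<n. M i k * N k j)"

definition mtrace :: "nat \<Rightarrow> rmat \<Rightarrow> real" where
  "mtrace n M = (\<Sum>i<n. M i i)"

text \<open>Powers of sums will be expanded in noncommuting letters, hence products of lists. Only
  entries with indices below \<open>n\<close> are meaningful, and the identity laws hold only
  there.\<close>

fun word_prod :: "nat \<Rightarrow> rmat list \<Rightarrow> rmat" where
  "word_prod n [] = (\<lambda>i j. if i = j then 1 else 0)"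
| "word_prod n (M # w) = mat_mult n M (word_prod n w)"

abbreviation "wtrace n w \<equiv> mtrace n (word_prod n w)"

lemma mat_mult_assoc: "mat_mult n (mat_mult n L M) N = mat_mult n L (mat_mult n M N)"
proof (intro ext)
  fix i j
  have "mat_mult n (mat_mult n L M) N i j = (\<Sum>k<n. \<Sum>l<n. L i l * M l k * N k j)"
    by (simp add: mat_mult_def sum_distrib_right)
  also have "\<dots> = (\<Sum>l<n. \<Sum>k<n. L i l * M l k * N k j)"
    by (rule sum.swap)
  finally show "mat_mult n (mat_mult n L M) N i j = mat_mult n L (mat_mult n M N) i j"
    by (simp add: mat_mult_def sum_distrib_left mult.assoc)
qed

lemma mat_mult_id_left:
  "i < n \<Longrightarrow> mat_mult n (\<lambda>i j. if i = j then 1 else 0) M i j = M i j"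
  by (simp add: mat_mult_def if_distrib[of "\<lambda>a. a * _"] cong: if_cong)

lemma mat_mult_id_right:
  "j < n \<Longrightarrow> mat_mult n M (\<lambda>i j. if i = j then 1 else 0) i j = M i j"
  by (simp add: mat_mult_def if_distrib cong: if_cong)

lemma mat_mult_cong:
  assumes "\<And>k. k < n \<Longrightarrow> M i k = M' i k" "\<And>k. k < n \<Longrightarrow> N k j = N' k j"
  shows "mat_mult n M N i j = mat_mult n M' N' i j"
  using assms by (simp add: mat_mult_def)

lemma word_prod_append:
  "i < n \<Longrightarrow> word_prod n (u @ v) i j = mat_mult n (word_prod n u) (word_prod n v) i j"
proof (induction u arbitrary: i)
  case (Cons M u)
  have "word_prod n ((M # u) @ v) i j = mat_mult n M (mat_mult n (word_prod n u) (word_prod n v)) i j"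
    by (simp, rule mat_mult_cong) (simp_all add: Cons.IH)
  then show ?case by (simp add: mat_mult_assoc)
qed (simp add: mat_mult_id_left)

lemma word_prod_rev:
  assumes "\<And>M. M \<in> set w \<Longrightarrow> symmetric_mat n M" "i < n" "j < n"
  shows "word_prod n (rev w) i j = word_prod n w j i"
  using assms
proof (induction w arbitrary: i j)
  case (Cons M w)
  have "word_prod n (rev (M # w)) i j = mat_mult n (word_prod n (rev w)) (word_prod n [M]) i j"
    using word_prod_append[of i n "rev w" "[M]" j] Cons.prems by simp
  also have "\<dots> = mat_mult n (\<lambda>i j. word_prod n w j i) (\<lambda>i j. M j i) i j"
    using Cons by (intro mat_mult_cong)
      (auto simp: mat_mult_id_right symmetric_mat_def)
  finally show ?case by (simp add: mat_mult_def mult.commute)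
qed auto

lemma wtrace_append: "wtrace n (u @ v) = (\<Sum>i<n. \<Sum>j<n. word_prod n u i j * word_prod n v j i)"
  by (simp add: mtrace_def word_prod_append mat_mult_def)

lemma wtrace_rotate: "wtrace n (u @ v) = wtrace n (v @ u)"
  unfolding wtrace_append by (subst sum.swap) (simp add: mult.commute)

text \<open>A word followed by its reversal has product \<open>U U^T\<close>, whose trace is the
  squared Frobenius norm of \<open>U\<close>.\<close>

lemma wtrace_append_rev:
  assumes "\<And>M. M \<in> set u \<Longrightarrow> symmetric_mat n M"
  shows "wtrace n (u @ rev u) = (\<Sum>i<n. \<Sum>j<n. (word_prod n u i j)\<^sup>2)"
  unfolding wtrace_append using word_prod_rev[OF assms]
  by (intro sum.cong refl) (simp add: power2_eq_square)

text \<open>The difference of the two sides is the squared Frobenius norm of \<open>U - V^T\<close>,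
  where \<open>U\<close> and \<open>V\<close> are the products of \<open>u\<close> and
  \<open>v\<close>.\<close>

lemma wtrace_reflect:
  assumes "\<And>M. M \<in> set u \<union> set v \<Longrightarrow> symmetric_mat n M"
  shows "2 * wtrace n (u @ v) \<le> wtrace n (u @ rev u) + wtrace n (rev v @ v)"
proof -
  have "wtrace n (u @ rev u) + wtrace n (rev v @ v) - 2 * wtrace n (u @ v)
      = (\<Sum>i<n. \<Sum>j<n. (word_prod n u i j - word_prod n v j i)\<^sup>2)"
  proof -
    have "wtrace n (rev v @ v) = (\<Sum>i<n. \<Sum>j<n. (word_prod n v j i)\<^sup>2)"
      using assms by (subst wtrace_rotate, subst wtrace_append_rev) (auto intro: sum.swap)
    moreover have "wtrace n (u @ rev u) = (\<Sum>i<n. \<Sum>j<n. (word_prod n u i j)\<^sup>2)"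
      using assms by (intro wtrace_append_rev) auto
    ultimately show ?thesis
      by (simp add: wtrace_append power2_diff sum.distrib sum_subtractf sum_distrib_left algebra_simps)
  qed
  moreover have "0 \<le> (\<Sum>i<n. \<Sum>j<n. (word_prod n u i j - word_prod n v j i)\<^sup>2)"
    by (intro sum_nonneg) auto
  ultimately show ?thesis by linarith
qed

lemma wtrace_even_power_nonneg:
  assumes "symmetric_mat n M"
  shows "0 \<le> wtrace n (replicate (2 * q) M)"
proof -
  have "wtrace n (replicate (2 * q) M) = wtrace n (replicate q M @ rev (replicate q M))"
    by (simp add: replicate_add[symmetric] mult_2)
  also have "\<dots> \<ge> 0"
    using assms by (subst wtrace_append_rev) (auto intro!: sum_nonneg)
  finally show ?thesis .
qed

text \<open>Reflecting a word of maximal trace at its middle gives words of maximal trace again, by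
  Cauchy--Schwarz; choosing the cut at the end of a run doubles the run. So a power of a single
  letter attains the maximum.\<close>

lemma wtrace_le_one:
  assumes sym: "\<And>M. M \<in> X \<Longrightarrow> symmetric_mat n M" and fin: "finite X"
    and norm: "\<And>M. M \<in> X \<Longrightarrow> wtrace n (replicate (2 ^ Suc s) M) \<le> 1"
    and w: "set w \<subseteq> X" "length w = 2 ^ Suc s"
  shows "wtrace n w \<le> 1"
proof -
  define W where "W = {w. set w \<subseteq> X \<and> length w = 2 ^ Suc s}"
  define T where "T = Max (wtrace n ` W)"
  have "finite W" unfolding W_def using fin by (rule finite_lists_length_eq)
  moreover have "w \<in> W" using w by (simp add: W_def)
  ultimately have le: "wtrace n u \<le> T" if "u \<in> W" for u
    using that by (simp add: T_def)
  have "T \<in> wtrace n ` W"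
    unfolding T_def using \<open>finite W\<close> \<open>w \<in> W\<close> by (intro Max_in) auto
  then obtain u where u: "u \<in> W" "wtrace n u = T" by auto
  \<comment> \<open>Invariant: some word of maximal trace begins with a run of \<open>2 ^ j\<close>
    equal letters. At \<open>j = Suc s\<close> the run is the whole word.\<close>
  have "\<exists>M v. replicate (2 ^ j) M @ v \<in> W \<and> wtrace n (replicate (2 ^ j) M @ v) = T"
    if "j \<le> Suc s" for j
    using that
  proof (induction j)
    case 0
    obtain M v where "u = M # v" using u(1) by (cases u) (auto simp: W_def)
    then show ?case using u by (intro exI[of _ M] exI[of _ v]) simp
  next
    case (Suc j)
    then obtain M v where v: "replicate (2 ^ j) M @ v \<in> W"
      "wtrace n (replicate (2 ^ j) M @ v) = T" by auto
    have js: "(2::nat) ^ j \<le> 2 ^ s" using Suc.prems by (intro power_increasing) auto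
    have len: "2 ^ j + length v = 2 * 2 ^ s" using v(1) by (simp add: W_def)
    have len': "2 ^ s \<le> length v" using len js by linarith
    \<comment> \<open>The word is rotated into \<open>v2 @ v1\<close>, two halves of equal length,
      with the run at the end of \<open>v2\<close>. Reflecting \<open>v2\<close> at its end doubles
      the run.\<close>
    define v1 where "v1 = take (2 ^ s) v"
    define v2 where "v2 = drop (2 ^ s) v @ replicate (2 ^ j) M"
    have X: "set v1 \<subseteq> X" "set v2 \<subseteq> X"
      using v(1) set_take_subset[of "2 ^ s" v] set_drop_subset[of "2 ^ s" v]
      by (auto simp: W_def v1_def v2_def)
    have lens: "length v1 = 2 ^ s" "length v2 = 2 ^ s"
      using len len' by (simp_all add: v1_def v2_def)
    have "wtrace n (v2 @ v1) = wtrace n (drop (2 ^ s) v @ (replicate (2 ^ j) M @ v1))"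
      by (simp add: v2_def)
    also have "\<dots> = wtrace n ((replicate (2 ^ j) M @ v1) @ drop (2 ^ s) v)"
      by (rule wtrace_rotate)
    also have "\<dots> = T" using v(2) by (simp add: v1_def)
    finally have "wtrace n (v2 @ v1) = T" .
    moreover have "wtrace n (v2 @ rev v2) \<le> T" "wtrace n (rev v1 @ v1) \<le> T"
      using X lens by (auto intro!: le simp: W_def)
    moreover have "2 * wtrace n (v2 @ v1) \<le> wtrace n (v2 @ rev v2) + wtrace n (rev v1 @ v1)"
      using X sym by (intro wtrace_reflect) auto
    \<comment> \<open>Both reflected words have trace at most \<open>T\<close>, yet their traces add
      up to at least \<open>2 * T\<close>.\<close>
    ultimately have "wtrace n (v2 @ rev v2) = T" by linarith
    moreover have "wtrace n (v2 @ rev v2)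
        = wtrace n ((replicate (2 ^ j) M @ replicate (2 ^ j) M) @ (rev (drop (2 ^ s) v) @ drop (2 ^ s) v))"
      using wtrace_rotate[of n "drop (2 ^ s) v"] by (simp add: v2_def)
    ultimately have "wtrace n (replicate (2 ^ Suc j) M @ (rev (drop (2 ^ s) v) @ drop (2 ^ s) v)) = T"
      by (simp add: replicate_add[symmetric] mult_2)
    moreover have "replicate (2 ^ Suc j) M @ (rev (drop (2 ^ s) v) @ drop (2 ^ s) v) \<in> W"
    proof -
      have "set v2 \<subseteq> X" "2 * length v2 = 2 ^ Suc s" using X lens by auto
      then show ?thesis by (auto simp: W_def v2_def)
    qed
    ultimately show ?case by blast
  qed
  from this[of "Suc s"] obtain M v where v: "replicate (2 ^ Suc s) M @ v \<in> W"
    "wtrace n (replicate (2 ^ Suc s) M @ v) = T" by auto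
  then have "v = []" by (simp add: W_def)
  moreover from v(1) have "M \<in> X" by (auto simp: W_def)
  ultimately have "T \<le> 1" using v(2) norm[of M] by simp
  then show ?thesis using le[OF \<open>w \<in> W\<close>] by linarith
qed

section \<open>Expanding powers of a sum over words in two letters\<close>

lemma word_prod_cmult:
  "word_prod n (map (\<lambda>b i j. c b * M b i j) bs) i j = prod_list (map c bs) * word_prod n (map M bs) i j"
proof (induction bs arbitrary: i)
  case (Cons b bs)
  then show ?case by (simp add: mat_mult_def sum_distrib_left mult_ac)
qed simp

text \<open>Each letter carries its own scalar, so the same rule serves to normalise letters and to
  insert signs.\<close>

lemma wtrace_cmult:
  "wtrace n (map (\<lambda>b i j. c b * M b i j) bs) = prod_list (map c bs) * wtrace n (map M bs)"
  by (simp add: mtrace_def word_prod_cmult sum_distrib_left)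

lemma wtrace_power_cmult:
  "wtrace n (replicate k (\<lambda>i j. c * M i j)) = c ^ k * wtrace n (replicate k M)"
  using wtrace_cmult[of n "\<lambda>_. c" "\<lambda>_. M" "replicate k ()"] by (simp add: map_replicate_const)

definition bool_words :: "nat \<Rightarrow> bool list set" where
  "bool_words k = {bs. length bs = k}"

lemma finite_bool_words: "finite (bool_words k)"
  using finite_lists_length_eq[of "UNIV :: bool set" k] by (simp add: bool_words_def)

lemma sum_bool_words_Suc:
  fixes f :: "bool list \<Rightarrow> real"
  shows "(\<Sum>bs\<in>bool_words (Suc k). f bs)
    = (\<Sum>bs\<in>bool_words k. f (True # bs)) + (\<Sum>bs\<in>bool_words k. f (False # bs))"
proof -
  have "bool_words (Suc k) = (Cons True) ` bool_words k \<union> (Cons False) ` bool_words k"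
  proof (intro equalityI subsetI)
    fix bs assume "bs \<in> bool_words (Suc k)"
    then obtain b cs where "bs = b # cs" "cs \<in> bool_words k"
      by (auto simp: bool_words_def length_Suc_conv)
    then show "bs \<in> (Cons True) ` bool_words k \<union> (Cons False) ` bool_words k"
      by (cases b) auto
  qed (auto simp: bool_words_def)
  moreover have "inj_on (Cons b) (bool_words k)" for b by (simp add: inj_on_def)
  moreover have "(Cons True) ` bool_words k \<inter> (Cons False) ` bool_words k = {}" by auto
  ultimately show ?thesis
    by (simp add: sum.union_disjoint finite_bool_words sum.reindex)
qed

text \<open>The noncommutative binomial theorem: a boolean word records which summand is taken from
  each factor.\<close>

lemma word_prod_expand:
  "word_prod n (replicate k (\<lambda>i j. M True i j + M False i j)) i j
    = (\<Sum>bs\<in>bool_words k. word_prod n (map M bs) i j)"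
proof (induction k arbitrary: i)
  case 0
  have "bool_words 0 = {[]}" by (auto simp: bool_words_def)
  then show ?case by simp
next
  case (Suc k)
  have "(\<Sum>bs\<in>bool_words k. word_prod n (map M (b # bs)) i j)
      = mat_mult n (M b) (word_prod n (replicate k (\<lambda>i j. M True i j + M False i j))) i j" for b
    unfolding mat_mult_def Suc.IH by (simp add: mat_mult_def sum_distrib_left, rule sum.swap)
  then show ?case
    unfolding sum_bool_words_Suc by (simp add: mat_mult_def algebra_simps sum.distrib)
qed

lemma wtrace_expand:
  "wtrace n (replicate k (\<lambda>i j. M True i j + M False i j)) = (\<Sum>bs\<in>bool_words k. wtrace n (map M bs))"
  unfolding mtrace_def word_prod_expand by (rule sum.swap)

text \<open>The scalar expansion over the same words, with which the matrix expansion is compared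
  term by term.\<close>

lemma power_expand:
  fixes c :: "bool \<Rightarrow> real"
  shows "(c True + c False) ^ k = (\<Sum>bs\<in>bool_words k. prod_list (map c bs))"
proof (induction k)
  case 0
  have "bool_words 0 = {[]}" by (auto simp: bool_words_def)
  then show ?case by simp
next
  case (Suc k)
  then show ?case unfolding sum_bool_words_Suc by (simp add: sum_distrib_left[symmetric] algebra_simps)
qed

text \<open>In the sum of both expansions, words with an odd number of letters \<open>Y\<close>
  cancel and the others are doubled. All coefficients being nonnegative, each trace may be replaced
  by its bound, the product of the corresponding scalars \<open>a\<close> and \<open>b\<close>, and
  the scalar expansion reassembles the result.\<close>

lemma wtrace_plus_minus:
  fixes a b :: real
  assumes sym: "symmetric_mat n H" "symmetric_mat n Y" and ab: "0 < a" "0 < b"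
    and H: "wtrace n (replicate (2 ^ Suc s) H) \<le> a ^ 2 ^ Suc s"
    and Y: "wtrace n (replicate (2 ^ Suc s) Y) \<le> b ^ 2 ^ Suc s"
  shows "wtrace n (replicate (2 ^ Suc s) (\<lambda>i j. H i j + Y i j))
       + wtrace n (replicate (2 ^ Suc s) (\<lambda>i j. H i j - Y i j))
       \<le> (a + b) ^ 2 ^ Suc s + (a - b) ^ 2 ^ Suc s"
proof -
  define p :: nat where "p = 2 ^ Suc s"
  define M where "M = (\<lambda>c. if c then H else Y)"
  define e where "e = (\<lambda>c. if c then a else b)"
  define sg where "sg = (\<lambda>c::bool. if c then 1 else - 1 :: real)"
  \<comment> \<open>Normalised letters satisfy the hypothesis of \<open>wtrace_le_one\<close>;
    scaling back bounds each word.\<close>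
  define X where "X = {\<lambda>i j. (1 / a) * H i j, \<lambda>i j. (1 / b) * Y i j}"
  have word: "wtrace n (map M bs) \<le> prod_list (map e bs)" if "bs \<in> bool_words p" for bs
  proof -
    have "wtrace n (map (\<lambda>c i j. (1 / e c) * M c i j) bs) \<le> 1"
    proof (rule wtrace_le_one[of X n s])
      show "set (map (\<lambda>c i j. (1 / e c) * M c i j) bs) \<subseteq> X"
        by (auto simp: X_def e_def M_def)
      show "wtrace n (replicate (2 ^ Suc s) L) \<le> 1" if "L \<in> X" for L
        using that ab H Y unfolding X_def
        by (auto simp only: insert_iff empty_iff wtrace_power_cmult power_divide) (simp_all add: field_simps)
    qed (use that sym in \<open>auto simp: X_def bool_words_def p_def symmetric_mat_def\<close>)
    also have "wtrace n (map (\<lambda>c i j. (1 / e c) * M c i j) bs)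
        = prod_list (map (\<lambda>c. 1 / e c) bs) * wtrace n (map M bs)"
      by (rule wtrace_cmult)
    also have "prod_list (map (\<lambda>c. 1 / e c) bs) = 1 / prod_list (map e bs)"
      by (induction bs) auto
    finally show ?thesis
    proof -
      have "prod_list (map e bs) > 0"
        using ab by (induction bs) (auto simp: e_def)
      then show "1 / prod_list (map e bs) * wtrace n (map M bs) \<le> 1 \<Longrightarrow> ?thesis"
        by (simp add: field_simps)
    qed
  qed
  have sgn1: "0 \<le> 1 + prod_list (map sg bs)" for bs
  proof -
    have "\<bar>prod_list (map sg bs)\<bar> = 1" by (induction bs) (auto simp: sg_def abs_mult)
    then show ?thesis by linarith
  qed
  have "wtrace n (replicate p (\<lambda>i j. H i j + Y i j)) = (\<Sum>bs\<in>bool_words p. wtrace n (map M bs))"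
    using wtrace_expand[of n p M] by (simp add: M_def)
  moreover have "wtrace n (replicate p (\<lambda>i j. H i j - Y i j))
      = (\<Sum>bs\<in>bool_words p. prod_list (map sg bs) * wtrace n (map M bs))"
    using wtrace_expand[of n p "\<lambda>c i j. sg c * M c i j"]
    unfolding wtrace_cmult by (simp add: M_def sg_def)
  ultimately have "wtrace n (replicate p (\<lambda>i j. H i j + Y i j)) + wtrace n (replicate p (\<lambda>i j. H i j - Y i j))
      = (\<Sum>bs\<in>bool_words p. (1 + prod_list (map sg bs)) * wtrace n (map M bs))"
    by (simp add: sum.distrib algebra_simps)
  also have "\<dots> \<le> (\<Sum>bs\<in>bool_words p. (1 + prod_list (map sg bs)) * prod_list (map e bs))"
    by (intro sum_mono mult_left_mono word sgn1)
  also have "\<dots> = (\<Sum>bs\<in>bool_words p. prod_list (map e bs))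
      + (\<Sum>bs\<in>bool_words p. prod_list (map (\<lambda>c. sg c * e c) bs))"
  proof -
    have "prod_list (map (\<lambda>c. sg c * e c) bs) = prod_list (map sg bs) * prod_list (map e bs)" for bs
      by (induction bs) auto
    then show ?thesis by (simp add: sum.distrib algebra_simps)
  qed
  also have "\<dots> = (a + b) ^ p + (a - b) ^ p"
    unfolding power_expand[symmetric] by (simp add: e_def sg_def)
  finally show ?thesis by (simp only: p_def)
qed

subsection \<open>Smoothness of Schatten norms\<close>

text \<open>The scalar case of 2-smoothness with constant \<open>p - 1\<close>, where
  \<open>p = 2 ^ Suc s\<close>. Squaring replaces \<open>a\<close> and \<open>b\<close> by
  \<open>a^2 + b^2\<close> and \<open>2 a b\<close> and halves the exponent, while the constant
  grows from \<open>c\<close> to \<open>2 c + 1\<close>.\<close>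

lemma two_point_inequality:
  fixes a b :: real
  shows "(a + b) ^ 2 ^ Suc s + (a - b) ^ 2 ^ Suc s \<le> 2 * (a\<^sup>2 + (2 ^ Suc s - 1) * b\<^sup>2) ^ 2 ^ s"
proof (induction s arbitrary: a b)
  case 0
  show ?case by (simp add: power2_eq_square algebra_simps)
next
  case (Suc s)
  define c :: real where "c = 2 ^ Suc s - 1"
  have c0: "0 \<le> c" using one_le_power[of "2::real" "Suc s"] by (simp add: c_def del: power_Suc)
  have "(a + b) ^ 2 ^ Suc (Suc s) + (a - b) ^ 2 ^ Suc (Suc s)
      = ((a + b)\<^sup>2) ^ 2 ^ Suc s + ((a - b)\<^sup>2) ^ 2 ^ Suc s"
    by (simp add: power_mult[symmetric])
  also have "\<dots> = ((a\<^sup>2 + b\<^sup>2) + 2 * a * b) ^ 2 ^ Suc s + ((a\<^sup>2 + b\<^sup>2) - 2 * a * b) ^ 2 ^ Suc s"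
    by (simp add: power2_eq_square algebra_simps)
  also have "\<dots> \<le> 2 * ((a\<^sup>2 + b\<^sup>2)\<^sup>2 + c * (2 * a * b)\<^sup>2) ^ 2 ^ s"
    unfolding c_def by (rule Suc.IH)
  also have "\<dots> \<le> 2 * ((a\<^sup>2 + (2 * c + 1) * b\<^sup>2)\<^sup>2) ^ 2 ^ s"
  proof -
    \<comment> \<open>The constant \<open>2 * c + 1\<close> exactly matches the mixed terms
      \<open>a^2 b^2\<close>, leaving a multiple of \<open>b^4\<close>.\<close>
    have "(a\<^sup>2 + (2 * c + 1) * b\<^sup>2)\<^sup>2 - ((a\<^sup>2 + b\<^sup>2)\<^sup>2 + c * (2 * a * b)\<^sup>2)
        = (4 * c\<^sup>2 + 4 * c) * (b\<^sup>2)\<^sup>2"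
      by (simp add: power2_eq_square algebra_simps)
    moreover have "0 \<le> (4 * c\<^sup>2 + 4 * c) * (b\<^sup>2)\<^sup>2" using c0 by simp
    ultimately have "(a\<^sup>2 + b\<^sup>2)\<^sup>2 + c * (2 * a * b)\<^sup>2 \<le> (a\<^sup>2 + (2 * c + 1) * b\<^sup>2)\<^sup>2" by linarith
    then show ?thesis using c0 by (intro mult_left_mono power_mono) auto
  qed
  also have "2 * c + 1 = 2 ^ Suc (Suc s) - 1" by (simp add: c_def)
  finally show ?case by (simp add: power_mult[symmetric])
qed

lemma power_mean_two:
  fixes x y :: real
  assumes "0 \<le> x" "0 \<le> y"
  shows "((x + y) / 2) ^ 2 ^ s \<le> (x ^ 2 ^ s + y ^ 2 ^ s) / 2"
  using assms
proof (induction s arbitrary: x y)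
  case (Suc s)
  have "((x + y) / 2) ^ 2 ^ Suc s = (((x + y) / 2)\<^sup>2) ^ 2 ^ s"
    by (simp add: power_mult[symmetric])
  also have "\<dots> \<le> ((x\<^sup>2 + y\<^sup>2) / 2) ^ 2 ^ s"
  proof -
    have "0 \<le> (x - y)\<^sup>2" by simp
    then have "((x + y) / 2)\<^sup>2 \<le> (x\<^sup>2 + y\<^sup>2) / 2" by (simp add: power2_eq_square field_simps)
    then show ?thesis by (intro power_mono) auto
  qed
  also have "\<dots> \<le> ((x\<^sup>2) ^ 2 ^ s + (y\<^sup>2) ^ 2 ^ s) / 2"
    by (rule Suc.IH) auto
  finally show ?case by (simp add: power_mult[symmetric])
qed simp

text \<open>The Schatten exponent is \<open>2 ^ Suc s\<close>; the root has half that order, hence the square.\<close>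

definition schatten_sq :: "nat \<Rightarrow> nat \<Rightarrow> rmat \<Rightarrow> real" where
  "schatten_sq n s H = root (2 ^ s) (wtrace n (replicate (2 ^ Suc s) H))"

lemma schatten_sq_nonneg: "symmetric_mat n H \<Longrightarrow> 0 \<le> schatten_sq n s H"
  using wtrace_even_power_nonneg[of n H "2 ^ s"] by (simp add: schatten_sq_def)

lemma schatten_sq_power:
  "symmetric_mat n H \<Longrightarrow> schatten_sq n s H ^ 2 ^ s = wtrace n (replicate (2 ^ Suc s) H)"
  using wtrace_even_power_nonneg[of n H "2 ^ s"] by (simp add: schatten_sq_def)

text \<open>Power means bound the left side by traces, the expansion over words reduces the traces
  to scalars, and the two-point inequality concludes. The \<open>h\<close> and \<open>g\<close>
  below are the Schatten norms themselves.\<close>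

lemma schatten_sq_smooth:
  assumes sym: "symmetric_mat n H" "symmetric_mat n Y"
  shows "schatten_sq n s (\<lambda>i j. H i j + Y i j) + schatten_sq n s (\<lambda>i j. H i j - Y i j)
    \<le> 2 * schatten_sq n s H + 2 * (2 ^ Suc s - 1) * schatten_sq n s Y" (is "?x + ?y \<le> _")
proof -
  define h where "h = sqrt (schatten_sq n s H)"
  define g where "g = sqrt (schatten_sq n s Y)"
  have sym': "symmetric_mat n (\<lambda>i j. H i j + Y i j)" "symmetric_mat n (\<lambda>i j. H i j - Y i j)"
    using sym by (auto simp: symmetric_mat_def)
  have nn: "0 \<le> h" "0 \<le> g" using schatten_sq_nonneg sym by (auto simp: h_def g_def)
  have hg: "h\<^sup>2 = schatten_sq n s H" "g\<^sup>2 = schatten_sq n s Y"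
    using schatten_sq_nonneg sym by (auto simp: h_def g_def)
  have pow: "h ^ 2 ^ Suc s = wtrace n (replicate (2 ^ Suc s) H)"
    "g ^ 2 ^ Suc s = wtrace n (replicate (2 ^ Suc s) Y)"
    using hg sym by (simp_all add: power_mult schatten_sq_power del: replicate.simps)
  \<comment> \<open>\<open>wtrace_plus_minus\<close> needs strictly positive bounds while the norms
    may vanish; hence the margin \<open>e\<close>, sent to 0 afterwards.\<close>
  have *: "?x + ?y \<le> 2 * ((h + e)\<^sup>2 + (2 ^ Suc s - 1) * (g + e)\<^sup>2)" if "e > 0" for e
  proof -
    define r where "r = (h + e)\<^sup>2 + (2 ^ Suc s - 1) * (g + e)\<^sup>2"
    have "(1::real) \<le> 2 ^ Suc s" by (rule one_le_power) simp
    then have r0: "0 \<le> r" by (auto simp: r_def)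
    have "((?x + ?y) / 2) ^ 2 ^ s \<le> (?x ^ 2 ^ s + ?y ^ 2 ^ s) / 2"
      using sym' by (intro power_mean_two schatten_sq_nonneg)
    also have "?x ^ 2 ^ s + ?y ^ 2 ^ s = wtrace n (replicate (2 ^ Suc s) (\<lambda>i j. H i j + Y i j))
        + wtrace n (replicate (2 ^ Suc s) (\<lambda>i j. H i j - Y i j))"
      using sym' by (simp only: schatten_sq_power)
    also have "\<dots> \<le> ((h + e) + (g + e)) ^ 2 ^ Suc s + ((h + e) - (g + e)) ^ 2 ^ Suc s"
      unfolding pow[symmetric]
    proof (rule wtrace_plus_minus[OF sym])
      show "wtrace n (replicate (2 ^ Suc s) H) \<le> (h + e) ^ 2 ^ Suc s"
        "wtrace n (replicate (2 ^ Suc s) Y) \<le> (g + e) ^ 2 ^ Suc s"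
        unfolding pow[symmetric] using nn that by (auto intro!: power_mono simp del: power_Suc)
    qed (use nn that in auto)
    also have "\<dots> \<le> 2 * r ^ 2 ^ s"
      unfolding r_def by (rule two_point_inequality)
    finally have "((?x + ?y) / 2) ^ 2 ^ s \<le> r ^ 2 ^ s" by simp
    then have "(?x + ?y) / 2 \<le> r"
      using r0 by (rule power_le_imp_le_base[of _ "2 ^ s - 1" for s, simplified])
    then show ?thesis by (simp add: r_def)
  qed
  have lim: "((\<lambda>e. 2 * ((h + e)\<^sup>2 + (2 ^ Suc s - 1) * (g + e)\<^sup>2)) \<longlongrightarrow>
      2 * ((h + 0)\<^sup>2 + (2 ^ Suc s - 1) * (g + 0)\<^sup>2)) (at_right 0)"
    by (intro tendsto_intros)
  have "?x + ?y \<le> 2 * ((h + 0)\<^sup>2 + (2 ^ Suc s - 1) * (g + 0)\<^sup>2)"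
    by (rule tendsto_lowerbound[OF lim])
      (rule eventually_mono[OF eventually_at_right_less[of 0]], rule *, simp_all)
  then show ?thesis by (simp add: hg algebra_simps)
qed

text \<open>With \<open>w = M u\<close>, expanding the nonnegative value of the form at
  \<open>u - w\<close> gives \<open>2 |w|^2 <= qf n M u + qf n M w\<close>, and the upper bound on
  \<open>M\<close> concludes without any diagonalisation.\<close>

lemma contraction_norm:
  assumes sym: "symmetric_mat n M" and psd: "\<And>v. 0 \<le> qf n M v" and le: "\<And>v. qf n M v \<le> sqnorm n v"
  shows "sqnorm n (\<lambda>i. \<Sum>j<n. M i j * u j) \<le> sqnorm n u"
proof -
  define w where "w = (\<lambda>i. \<Sum>j<n. M i j * u j)"
  have qfw: "(\<Sum>i<n. v i * (\<Sum>j<n. M i j * z j)) = (\<Sum>i<n. \<Sum>j<n. M i j * v i * z j)" for v z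
    by (simp add: sum_distrib_left mult_ac)
  have cross: "(\<Sum>i<n. \<Sum>j<n. M i j * u i * w j) = sqnorm n w"
  proof -
    have "(\<Sum>i<n. \<Sum>j<n. M i j * u i * w j) = (\<Sum>j<n. \<Sum>i<n. M i j * u i * w j)"
      by (rule sum.swap)
    also have "\<dots> = (\<Sum>j<n. w j * (\<Sum>i<n. M j i * u i))"
      using sym by (auto simp: symmetric_mat_def sum_distrib_left mult_ac intro!: sum.cong)
    finally show ?thesis by (simp add: w_def sqnorm_def power2_eq_square)
  qed
  have cross': "(\<Sum>i<n. \<Sum>j<n. M i j * w i * u j) = sqnorm n w"
    unfolding qfw[symmetric] by (simp add: w_def sqnorm_def power2_eq_square)
  have "qf n M (\<lambda>i. u i - w i) = qf n M u - (\<Sum>i<n. \<Sum>j<n. M i j * u i * w j)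
      - (\<Sum>i<n. \<Sum>j<n. M i j * w i * u j) + qf n M w"
    by (simp add: qf_def algebra_simps sum.distrib sum_subtractf)
  also have "\<dots> = qf n M u - 2 * sqnorm n w + qf n M w"
    by (simp add: cross cross')
  finally have "2 * sqnorm n w \<le> qf n M u + qf n M w"
    using psd[of "\<lambda>i. u i - w i"] by linarith
  then have "sqnorm n w \<le> sqnorm n u" using le[of u] le[of w] by linarith
  then show ?thesis by (simp add: w_def)
qed

text \<open>The trace is the sum of the squared norms of the \<open>n\<close> columns of the
  \<open>q\<close>-th power, which are images of unit vectors under repeated contraction.\<close>

lemma wtrace_contraction:
  assumes sym: "symmetric_mat n M" and psd: "\<And>v. 0 \<le> qf n M v" and le: "\<And>v. qf n M v \<le> sqnorm n v"
  shows "wtrace n (replicate (2 * q) M) \<le> real n"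
proof -
  have col: "sqnorm n (\<lambda>i. word_prod n (replicate q M) i a) \<le> 1" if "a < n" for a
  proof (induction q)
    case 0
    show ?case
      using that by (simp add: sqnorm_def power2_eq_square if_distrib[of "\<lambda>b. b * _"] cong: if_cong)
  next
    case (Suc q)
    then show ?case
      using contraction_norm[OF assms, of "\<lambda>i. word_prod n (replicate q M) i a"]
      by (simp add: mat_mult_def[abs_def])
  qed
  have "wtrace n (replicate (2 * q) M) = wtrace n (replicate q M @ rev (replicate q M))"
    by (simp add: replicate_add[symmetric] mult_2)
  also have "\<dots> = (\<Sum>i<n. \<Sum>a<n. (word_prod n (replicate q M) i a)\<^sup>2)"
    using sym by (subst wtrace_append_rev) auto
  also have "\<dots> = (\<Sum>a<n. sqnorm n (\<lambda>i. word_prod n (replicate q M) i a))"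
    unfolding sqnorm_def by (rule sum.swap)
  also have "\<dots> \<le> (\<Sum>a<n. 1)"
    using col by (intro sum_mono) auto
  finally show ?thesis by simp
qed

text \<open>\<open>C\<close> bounds the \<open>p\<close>-th root of \<open>n\<close> for
  \<open>p = 2 ^ Suc s\<close>; an exponent of order \<open>ln n\<close> makes it an absolute
  constant.\<close>

lemma schatten_sq_contraction:
  assumes "symmetric_mat n M" "\<And>v. 0 \<le> qf n M v" "\<And>v. qf n M v \<le> sqnorm n v"
    and C: "0 \<le> C" "real n \<le> C ^ 2 ^ Suc s"
  shows "schatten_sq n s (\<lambda>i j. t * M i j) \<le> t\<^sup>2 * C\<^sup>2"
proof -
  have "wtrace n (replicate (2 ^ Suc s) (\<lambda>i j. t * M i j))
      = t ^ 2 ^ Suc s * wtrace n (replicate (2 * 2 ^ s) M)"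
    by (simp only: wtrace_power_cmult power_Suc)
  also have "\<dots> \<le> t ^ 2 ^ Suc s * C ^ 2 ^ Suc s"
    using wtrace_contraction[OF assms(1-3), of "2 ^ s"] C(2)
    by (intro mult_left_mono) (auto simp: power_mult)
  also have "\<dots> = (t\<^sup>2 * C\<^sup>2) ^ 2 ^ s"
    by (simp add: power_mult power_mult_distrib)
  finally have "schatten_sq n s (\<lambda>i j. t * M i j) \<le> root (2 ^ s) ((t\<^sup>2 * C\<^sup>2) ^ 2 ^ s)"
    unfolding schatten_sq_def by (intro real_root_le_mono) auto
  then show ?thesis by (simp add: real_root_power_cancel)
qed

section \<open>Second moments tested against Schatten norms\<close>

lemma qf_word_double:
  assumes sym: "symmetric_mat n M"
  shows "qf n (word_prod n (replicate (2 * q) M)) x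
    = sqnorm n (\<lambda>i. \<Sum>j<n. word_prod n (replicate q M) i j * x j)"
proof -
  define K where "K = word_prod n (replicate q M)"
  have "qf n (word_prod n (replicate (2 * q) M)) x
      = qf n (\<lambda>i j. \<Sum>k<n. K k i * K k j) x"
  proof (rule qf_cong)
    fix i j assume ij: "i < n" "j < n"
    have "word_prod n (replicate (2 * q) M) i j = mat_mult n K K i j"
      using word_prod_append[OF ij(1), of "replicate q M" "replicate q M" j]
      by (simp add: K_def replicate_add[symmetric] mult_2)
    also have "\<dots> = (\<Sum>k<n. K k i * K k j)"
      unfolding mat_mult_def using word_prod_rev[of "replicate q M" n] sym ij
      by (intro sum.cong) (auto simp: K_def)
    finally show "word_prod n (replicate (2 * q) M) i j = (\<Sum>k<n. K k i * K k j)" .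
  qed
  also have "\<dots> = (\<Sum>k<n. (\<Sum>j<n. K k j * x j)\<^sup>2)"
    by (rule gram_qf) auto
  finally show ?thesis by (simp add: K_def sqnorm_def)
qed

text \<open>Cauchy-Schwarz, from Lagrange's identity.\<close>

lemma sum_mult_le_sqnorm:
  "(\<Sum>i<n. u i * x i)\<^sup>2 \<le> sqnorm n u * sqnorm n x"
proof -
  have "0 \<le> (\<Sum>i<n. \<Sum>j<n. (u i * x j - u j * x i)\<^sup>2)"
    by (intro sum_nonneg) auto
  also have "\<dots> = (\<Sum>i<n. \<Sum>j<n. (u i)\<^sup>2 * (x j)\<^sup>2) + (\<Sum>i<n. \<Sum>j<n. (x i)\<^sup>2 * (u j)\<^sup>2)
      - 2 * (\<Sum>i<n. \<Sum>j<n. (u i * x i) * (u j * x j))"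
    by (simp add: power2_diff power_mult_distrib sum.distrib sum_subtractf sum_distrib_left mult_ac)
  also have "\<dots> = 2 * (sqnorm n u * sqnorm n x) - 2 * (\<Sum>i<n. u i * x i)\<^sup>2"
    unfolding sum_product[symmetric] sqnorm_def[symmetric] by (simp add: power2_eq_square)
  finally show ?thesis by simp
qed

text \<open>A state \<open>\<rho> = \<Sum>l. v\<^sub>l v\<^sub>l\<^sup>T\<close> has \<open>\<rho>(H)\<^sup>2 \<le> \<rho>(H\<^sup>2)\<close>; iterate this.\<close>

lemma state_qf_power:
  fixes r :: nat
  assumes sym: "symmetric_mat n H" and v: "(\<Sum>l<r. sqnorm n (v l)) = 1"
  shows "(\<Sum>l<r. qf n H (v l)) ^ 2 ^ s \<le> (\<Sum>l<r. qf n (word_prod n (replicate (2 ^ s) H)) (v l))"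
proof (induction s)
  case 0
  have "qf n (word_prod n [H]) x = qf n H x" for x
    by (rule qf_cong) (simp add: mat_mult_id_right)
  then show ?case by simp
next
  case (Suc s)
  define K where "K = word_prod n (replicate (2 ^ s) H)"
  define h where "h = (\<Sum>l<r. qf n K (v l))"
  have q: "qf n K x = (\<Sum>i<n. x i * (\<Sum>j<n. K i j * x j))" for x
    by (simp add: qf_def sum_distrib_left mult_ac)
  \<comment> \<open>Nonnegativity of the variance of \<open>K\<close> in the state: a sum of squared
    norms of \<open>(K - h) v_l\<close>.\<close>
  have "0 \<le> (\<Sum>l<r. \<Sum>i<n. ((\<Sum>j<n. K i j * v l j) - h * v l i)\<^sup>2)"
    by (intro sum_nonneg) auto
  also have "\<dots> = (\<Sum>l<r. sqnorm n (\<lambda>i. \<Sum>j<n. K i j * v l j)) - 2 * h * (\<Sum>l<r. qf n K (v l))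
      + h\<^sup>2 * (\<Sum>l<r. sqnorm n (v l))"
    by (simp add: q sqnorm_def power2_diff power_mult_distrib sum.distrib sum_subtractf sum_distrib_left
        mult_ac)
  also have "\<dots> = (\<Sum>l<r. qf n (word_prod n (replicate (2 * 2 ^ s) H)) (v l)) - h\<^sup>2"
    by (simp only: v qf_word_double[OF sym] K_def[symmetric] h_def[symmetric])
      (simp add: power2_eq_square)
  finally have *: "h\<^sup>2 \<le> (\<Sum>l<r. qf n (word_prod n (replicate (2 ^ Suc s) H)) (v l))"
    by simp
  show ?case
  \<comment> \<open>Squaring the induction hypothesis requires its left side to be nonnegative. This
    holds when \<open>2 ^ s\<close> is even, so \<open>s = 0\<close> is separate.\<close>
  proof (cases s)
    case 0
    have "h = (\<Sum>l<r. qf n H (v l))"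
      unfolding h_def K_def 0 by (intro sum.cong refl qf_cong) (simp add: mat_mult_id_right)
    then show ?thesis using * by (simp add: 0)
  next
    case s: (Suc s')
    have "(\<Sum>l<r. qf n H (v l)) ^ 2 ^ Suc s = ((\<Sum>l<r. qf n H (v l)) ^ 2 ^ s)\<^sup>2"
      by (simp add: power_mult[symmetric] mult.commute)
    also have "\<dots> \<le> h\<^sup>2"
      using Suc.IH by (intro power_mono) (auto simp: h_def K_def s power_mult)
    finally show ?thesis using * by simp
  qed
qed

text \<open>For \<open>p = 2 ^ Suc s\<close>, \<open>h^p\<close> is at most the value of the state
  at \<open>H^p\<close>, which is at most the trace of \<open>H^p\<close> since the state has trace
  one. Hence \<open>h^2 <= schatten_sq n s H\<close>, and \<open>2 h - h^2 <= 1\<close>.\<close>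

lemma state_qf_le_schatten:
  fixes r :: nat
  assumes sym: "symmetric_mat n H" and v: "(\<Sum>l<r. sqnorm n (v l)) = 1"
  shows "2 * (\<Sum>l<r. qf n H (v l)) - schatten_sq n s H \<le> 1"
proof -
  define h where "h = (\<Sum>l<r. qf n H (v l))"
  define K where "K = word_prod n (replicate (2 ^ s) H)"
  have "(h\<^sup>2) ^ 2 ^ s = h ^ 2 ^ Suc s"
    by (simp add: power_mult[symmetric])
  also have "\<dots> \<le> (\<Sum>l<r. qf n (word_prod n (replicate (2 * 2 ^ s) H)) (v l))"
    using state_qf_power[OF sym v, of "Suc s"] by (simp add: h_def)
  also have "\<dots> = (\<Sum>l<r. \<Sum>i<n. (\<Sum>j<n. K i j * v l j)\<^sup>2)"
    unfolding qf_word_double[OF sym] by (simp add: K_def sqnorm_def)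
  also have "\<dots> \<le> (\<Sum>l<r. \<Sum>i<n. sqnorm n (K i) * sqnorm n (v l))"
    by (intro sum_mono sum_mult_le_sqnorm)
  also have "\<dots> = (\<Sum>i<n. sqnorm n (K i)) * (\<Sum>l<r. sqnorm n (v l))"
    by (simp add: sum_product[symmetric] sum_distrib_left[symmetric] sum_distrib_right[symmetric])
  also have "\<dots> = wtrace n (replicate (2 ^ s) H @ rev (replicate (2 ^ s) H))"
    unfolding v using sym by (subst wtrace_append_rev) (auto simp: K_def sqnorm_def)
  also have "\<dots> = schatten_sq n s H ^ 2 ^ s"
    by (simp add: schatten_sq_power[OF sym] replicate_add[symmetric] mult_2 del: replicate.simps)
  finally have "h\<^sup>2 \<le> schatten_sq n s H"
    using schatten_sq_nonneg[OF sym] by (intro power_le_imp_le_base[of "h\<^sup>2" "2 ^ s - 1"]) auto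
  moreover have "0 \<le> (h - 1)\<^sup>2" by simp
  ultimately show ?thesis unfolding h_def[symmetric] by (simp add: power2_eq_square algebra_simps)
qed

lemma pseudoexp_qf_le_schatten:
  assumes E: "pseudoexp n d E" "2 \<le> d" and norm: "E (sqnorm n) = 1" and sym: "symmetric_mat n H"
  shows "2 * E (qf n H) - schatten_sq n s H \<le> 1"
proof -
  obtain v where v: "\<And>M. E (qf n M) = (\<Sum>l<n. qf n M (v l))"
    using pseudoexp_qf_gram[OF E] by blast
  have id: "qf n (\<lambda>i j. if i = j then 1 else 0) = sqnorm n"
    by (simp add: fun_eq_iff qf_def sqnorm_def power2_eq_square if_distrib[of "\<lambda>a. a * _"] cong: if_cong)
  have "(\<Sum>l<n. sqnorm n (v l)) = 1"
    using v[of "\<lambda>i j. if i = j then 1 else 0"] norm by (simp add: id)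
  then show ?thesis using state_qf_le_schatten[OF sym] by (simp add: v)
qed

subsection \<open>Conditioning\<close>

text \<open>A set of quadratic constraints lets one conditioning argument serve both parts: the
  sphere alone, or the sphere together with the two block constraints.\<close>

definition annihilates :: "nat \<Rightarrow> nat \<Rightarrow> (((nat \<Rightarrow> real) \<Rightarrow> real) \<Rightarrow> real) \<Rightarrow> ((nat \<Rightarrow> real) \<Rightarrow> real) set \<Rightarrow> bool"
  where "annihilates n d E C \<longleftrightarrow> (\<forall>c\<in>C. \<forall>Q\<in>polys n (d - 2). E (\<lambda>x. c x * Q x) = 0)"

lemma annihilates_antimono:
  assumes "annihilates n d E C" "e \<le> d"
  shows "annihilates n e E C"
  using assms polys_mono[of _ n "e - 2" "d - 2"] unfolding annihilates_def by (meson diff_le_mono)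

lemma annihilates_sqnorm:
  assumes E: "pseudoexp n d E" and C: "annihilates n d E C" "(\<lambda>x. sqnorm n x - 1) \<in> C"
    and Q: "Q \<in> polys n (d - 2)" and d: "2 \<le> d"
  shows "E (\<lambda>x. sqnorm n x * Q x) = E Q"
proof -
  have "(\<lambda>x. sqnorm n x * Q x) \<in> polys n d" "Q \<in> polys n d"
    using polys_mult[OF polys_sqnorm Q, of d] polys_mono[OF Q, of d] d by auto
  then have "E (\<lambda>x. sqnorm n x * Q x - Q x) = E (\<lambda>x. sqnorm n x * Q x) - E Q"
    by (intro pseudoexp_diff[OF E])
  moreover have "E (\<lambda>x. (sqnorm n x - 1) * Q x) = 0"
    using C Q by (auto simp: annihilates_def)
  ultimately show ?thesis by (simp add: left_diff_distrib)
qed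

text \<open>The form is a sum of squares of linear forms, so its product with \<open>Q^2\<close> is
  a sum of squares of polynomials of degree one higher. This is why conditioning preserves
  positivity.\<close>

lemma qf_mult_nonneg:
  assumes E: "pseudoexp n d E" and B: "symmetric_mat n B" "\<And>v. 0 \<le> qf n B v"
    and Q: "Q \<in> polys n k" "2 * Suc k \<le> d"
  shows "0 \<le> E (\<lambda>x. qf n B x * (Q x)\<^sup>2)"
proof -
  obtain v where v: "\<forall>i<n. \<forall>j<n. B i j = (\<Sum>l<n. v l i * v l j)"
    using psd_gram[OF B] by blast
  have lQ: "(\<lambda>x. (\<Sum>i<n. v l i * x i) * Q x) \<in> polys n (Suc k)" for l
    by (rule polys_mult[OF polys_linear Q(1)]) simp
  have "E (\<lambda>x. qf n B x * (Q x)\<^sup>2) = E (\<lambda>x. \<Sum>l<n. ((\<Sum>i<n. v l i * x i) * Q x)\<^sup>2)"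
    by (simp only: gram_qf[OF v] sum_distrib_right[of _ _ "(_ :: real)\<^sup>2"] power_mult_distrib)
  also have "\<dots> = (\<Sum>l<n. E (\<lambda>x. ((\<Sum>i<n. v l i * x i) * Q x)\<^sup>2))"
    by (intro pseudoexp_sum[OF E] polys_power2[OF lQ] Q(2))
  also have "\<dots> \<ge> 0"
    by (intro sum_nonneg pseudoexp_square[OF E lQ Q(2)])
  finally show ?thesis .
qed

text \<open>Handles the forms of expectation zero, on which one cannot condition: they contribute
  nothing to averages.\<close>

lemma qf_mult_null:
  assumes E: "pseudoexp n d E" and B: "symmetric_mat n B" "\<And>v. 0 \<le> qf n B v"
    and f: "f \<in> polys n k" "2 * Suc k \<le> d" and null: "E (qf n B) = 0"
  shows "E (\<lambda>x. qf n B x * f x) = 0"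
proof -
  obtain v where v: "\<forall>i<n. \<forall>j<n. B i j = (\<Sum>l<n. v l i * v l j)"
    using psd_gram[OF B] by blast
  define w where "w = (\<lambda>l x. \<Sum>i<n. v l i * x i)"
  have w: "w l \<in> polys n 1" for l
    unfolding w_def by (rule polys_linear)
  have w': "w l \<in> polys n (Suc k)" for l
    using polys_mono[OF w, of "Suc k"] by simp
  have w2: "(\<lambda>x. (w l x)\<^sup>2) \<in> polys n d" for l
    using polys_power2[OF w', of d] f(2) by simp
  have B_eq: "qf n B x = (\<Sum>l<n. (w l x)\<^sup>2)" for x
    unfolding w_def by (rule gram_qf[OF v])
  have wf: "(\<lambda>x. w l x * f x) \<in> polys n (Suc k)" for l
    by (rule polys_mult[OF w f(1)]) simp
  have wwf: "(\<lambda>x. w l x * (w l x * f x)) \<in> polys n d" for l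
    by (rule polys_mult[OF w wf]) (use f(2) in simp)
  have "(\<Sum>l<n. E (\<lambda>x. (w l x)\<^sup>2)) = E (qf n B)"
    using pseudoexp_sum[OF E, of "{..<n}" "\<lambda>l x. (w l x)\<^sup>2"] w2 B_eq by (simp add: B_eq[abs_def])
  then have "E (\<lambda>x. (w l x)\<^sup>2) = 0" if "l < n" for l
    using null that pseudoexp_square[OF E w' f(2)]
      sum_nonneg_eq_0_iff[of "{..<n}" "\<lambda>l. E (\<lambda>x. (w l x)\<^sup>2)"] by simp
  then have "E (\<lambda>x. w l x * (w l x * f x)) = 0" if "l < n" for l
    using pseudoexp_null[OF E w' f(2) wf] that by blast
  moreover have "E (\<lambda>x. qf n B x * f x) = (\<Sum>l<n. E (\<lambda>x. w l x * (w l x * f x)))"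
    using pseudoexp_sum[OF E, of "{..<n}" "\<lambda>l x. w l x * (w l x * f x)"] wwf
    by (simp add: B_eq sum_distrib_right power2_eq_square mult.assoc)
  ultimately show ?thesis by simp
qed

text \<open>Reweighting by \<open>g / E g\<close>, as in a change of density; for a quadratic form
  \<open>g\<close> it costs two levels.\<close>

definition condition_on :: "(((nat \<Rightarrow> real) \<Rightarrow> real) \<Rightarrow> real) \<Rightarrow> ((nat \<Rightarrow> real) \<Rightarrow> real) \<Rightarrow>
    ((nat \<Rightarrow> real) \<Rightarrow> real) \<Rightarrow> real" where
  "condition_on E g f = E (\<lambda>x. g x * f x) / E g"

lemma pseudoexp_condition_on:
  assumes E: "pseudoexp n (d + 2) E" and B: "symmetric_mat n B" "\<And>v. 0 \<le> qf n B v"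
    and pos: "0 < E (qf n B)"
  shows "pseudoexp n d (condition_on E (qf n B))"
  unfolding pseudoexp_def
proof (intro conjI ballI allI)
  fix f g :: "(nat \<Rightarrow> real) \<Rightarrow> real" and a b :: real
  assume "f \<in> polys n d" "g \<in> polys n d"
  then have p: "(\<lambda>x. qf n B x * f x) \<in> polys n (d + 2)" "(\<lambda>x. qf n B x * g x) \<in> polys n (d + 2)"
    by (auto intro: polys_mult[OF polys_qf])
  show "condition_on E (qf n B) (\<lambda>x. a * f x + b * g x)
      = a * condition_on E (qf n B) f + b * condition_on E (qf n B) g"
    using pseudoexp_lin[OF E p, of a b]
    by (simp add: condition_on_def algebra_simps add_divide_distrib[symmetric])
next
  show "condition_on E (qf n B) (\<lambda>x. 1) = 1"
    using pos by (simp add: condition_on_def)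
next
  fix Q assume Q: "Q \<in> polys n (d div 2)"
  show "0 \<le> condition_on E (qf n B) (\<lambda>x. (Q x)\<^sup>2)"
    using qf_mult_nonneg[OF E B Q] pos by (simp add: condition_on_def)
qed

lemma annihilates_condition_on:
  assumes "annihilates n (d + 2) E C" "2 \<le> d"
  shows "annihilates n d (condition_on E (qf n B)) C"
  unfolding annihilates_def
proof (intro ballI)
  fix c Q assume c: "c \<in> C" and Q: "Q \<in> polys n (d - 2)"
  have "(\<lambda>x. qf n B x * Q x) \<in> polys n (d + 2 - 2)"
    \<comment> \<open>Subtraction is truncated, so \<open>2 \<le> d\<close> is what makes
      \<open>d - 2 + 2\<close> equal to \<open>d\<close>.\<close>
    by (rule polys_mult[OF polys_qf Q]) (use assms(2) in simp)
  then have "E (\<lambda>x. c x * (qf n B x * Q x)) = 0"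
    using assms c by (auto simp: annihilates_def)
  then show "condition_on E (qf n B) (\<lambda>x. c x * Q x) = 0"
    by (simp add: condition_on_def mult.left_commute)
qed

text \<open>A potential argument. Let \<open>\<rho>\<close> be the second moments of \<open>E\<close> and
  \<open>\<Phi>(\<rho>) = sup\<^sub>H 2 \<rho>(H) - N H\<close>. If \<open>E P\<close> exceeds \<open>\<beta>\<close>, then conditioning on a
  random \<open>B\<^sub>i\<close> changes \<open>\<rho>(A\<^sub>i)\<close>, and smoothness of \<open>N\<close> makes \<open>\<Phi>\<close> increase on average,
  while \<open>0 \<le> \<Phi> \<le> 1\<close> and \<open>E P\<close> is preserved on average.\<close>

lemma conditioning_bound:
  fixes N :: "rmat \<Rightarrow> real"
  assumes C: "(\<lambda>x. sqnorm n x - 1) \<in> C"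
    and symA: "\<And>i. i < m \<Longrightarrow> symmetric_mat n (A i)"
    and B: "\<And>i. i < m \<Longrightarrow> symmetric_mat n (B i)" "\<And>i v. i < m \<Longrightarrow> 0 \<le> qf n (B i) v"
    and sumB: "\<And>v. (\<Sum>i<m. qf n (B i) v) = sqnorm n v"
    and \<beta>: "\<And>L. pseudoexp n 4 L \<Longrightarrow> annihilates n 4 L C \<Longrightarrow> (\<Sum>i<m. L (qf n (A i)) * L (qf n (B i))) \<le> \<beta>"
    and smooth: "\<And>H Y. symmetric_mat n H \<Longrightarrow> symmetric_mat n Y \<Longrightarrow>
      N (\<lambda>i j. H i j + Y i j) + N (\<lambda>i j. H i j - Y i j) \<le> 2 * N H + 2 * c * N Y"
    and t: "0 \<le> t"
    and NA: "\<And>i. i < m \<Longrightarrow> c * N (\<lambda>a b. t * A i a b) \<le> t * \<gamma>"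
    and bound: "\<And>L H. pseudoexp n 4 L \<Longrightarrow> annihilates n 4 L C \<Longrightarrow> symmetric_mat n H \<Longrightarrow>
      2 * L (qf n H) - N H \<le> 1"
    and E: "pseudoexp n (2 * k + 8) E" "annihilates n (2 * k + 8) E C"
    and H: "symmetric_mat n H"
  shows "2 * E (qf n H) - N H + 2 * t * k * (E (Ppoly n m A B) - \<beta> - \<gamma>) \<le> 1"
  using E H
proof (induction k arbitrary: E H)
  case 0
  \<comment> \<open>Each round consumes two levels; after the last one only level 4 has to
    remain.\<close>
  have "pseudoexp n 4 E" "annihilates n 4 E C"
    using pseudoexp_antimono[OF 0(1)] annihilates_antimono[OF 0(2)] by auto
  then show ?case using bound 0(3) by simp
next
  case (Suc k)
  define d where "d = 2 * k + 8"
  define P where "P = Ppoly n m A B"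
  define \<tau> where "\<tau> = (\<lambda>i. E (qf n (B i)))"
  have E: "pseudoexp n (d + 2) E" and ann: "annihilates n (d + 2) E C"
    using Suc.prems(1,2) by (auto simp: d_def)
  have d8: "8 \<le> d" by (simp add: d_def)
  have pP: "P \<in> polys n 4" unfolding P_def by (rule polys_Ppoly)
  have \<tau>0: "0 \<le> \<tau> i" if "i < m" for i
    using qf_mult_nonneg[OF E B(1)[OF that] B(2)[OF that] polys_const[of 1 n 0]] by (simp add: \<tau>_def)
  \<comment> \<open>Law of total expectation: the \<open>B i\<close> sum to the squared norm, which
    acts as 1.\<close>
  have total: "(\<Sum>i<m. E (\<lambda>x. qf n (B i) x * f x)) = E f" if f: "f \<in> polys n 4" for f
  proof -
    have "(\<lambda>x. qf n (B i) x * f x) \<in> polys n (d + 2)" for i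
      by (rule polys_mult[OF polys_qf f]) (use d8 in simp)
    then have "(\<Sum>i<m. E (\<lambda>x. qf n (B i) x * f x)) = E (\<lambda>x. \<Sum>i<m. qf n (B i) x * f x)"
      by (intro pseudoexp_sum[OF E, symmetric])
    also have "\<dots> = E (\<lambda>x. sqnorm n x * f x)"
      by (simp add: sum_distrib_right[symmetric] sumB)
    also have "\<dots> = E f"
      using d8 by (intro annihilates_sqnorm[OF E ann C] polys_mono[OF f]) auto
    finally show ?thesis .
  qed
  have total\<tau>: "(\<Sum>i<m. \<tau> i) = 1"
    using total[OF polys_const[of 1]] pseudoexp_one[OF E] by (simp add: \<tau>_def)
  have qf4: "qf n M \<in> polys n 4" for M by (rule polys_mono[OF polys_qf]) simp
  have Eqf: "E (\<lambda>x. g x * qf n (\<lambda>a b. M a b + s * L a b) x)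
      = E (\<lambda>x. g x * qf n M x) + s * E (\<lambda>x. g x * qf n L x)"
    if "g \<in> polys n 2" for M L s g
    using pseudoexp_lin[OF E, of "\<lambda>x. g x * qf n M x" "\<lambda>x. g x * qf n L x" 1 s]
      polys_mult[OF that polys_qf, of "d + 2"] d8
    by (simp add: qf_add qf_cmult algebra_simps)
  \<comment> \<open>The induction hypothesis for \<open>E\<close> conditioned on \<open>B i\<close>,
    multiplied by the probability \<open>\<tau> i\<close> so that \<open>\<tau> i = 0\<close> is
    included.\<close>
  have step: "2 * E (\<lambda>x. qf n (B i) x * qf n G x) - \<tau> i * N G
      + 2 * t * k * (E (\<lambda>x. qf n (B i) x * P x) - \<tau> i * (\<beta> + \<gamma>)) \<le> \<tau> i"
    if i: "i < m" and G: "symmetric_mat n G" for i G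
  proof (cases "\<tau> i = 0")
    case True
    have "E (\<lambda>x. qf n (B i) x * f x) = 0" if "f \<in> polys n 4" for f
      using qf_mult_null[OF E B(1)[OF i] B(2)[OF i] that] d8 True by (simp add: \<tau>_def)
    from this[OF pP] this[OF qf4[of G]] show ?thesis by (simp add: True)
  next
    case False
    with \<tau>0[OF i] have pos: "0 < \<tau> i" by simp
    define L where "L = condition_on E (qf n (B i))"
    have "pseudoexp n d L"
      unfolding L_def using pos by (intro pseudoexp_condition_on[OF E B(1)[OF i] B(2)[OF i]]) (simp add: \<tau>_def)
    moreover have "annihilates n d L C"
      unfolding L_def by (rule annihilates_condition_on[OF ann]) (use d8 in simp)
    ultimately have "2 * L (qf n G) - N G + 2 * t * k * (L P - \<beta> - \<gamma>) \<le> 1"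
      using Suc.IH[OF _ _ G] by (simp add: d_def P_def)
    then have "\<tau> i * (2 * L (qf n G) - N G + 2 * t * k * (L P - \<beta> - \<gamma>)) \<le> \<tau> i"
      using pos by simp
    moreover have "\<tau> i * (2 * L (qf n G) - N G + 2 * t * k * (L P - \<beta> - \<gamma>))
        = 2 * (\<tau> i * L (qf n G)) - \<tau> i * N G + 2 * t * k * (\<tau> i * L P - \<tau> i * (\<beta> + \<gamma>))"
      by (simp add: algebra_simps)
    moreover have "\<tau> i * L f = E (\<lambda>x. qf n (B i) x * f x)" for f
      using pos by (simp add: L_def condition_on_def \<tau>_def)
    ultimately show ?thesis by simp
  qed
  define \<Phi> where "\<Phi> = Sup ((\<lambda>G. 2 * E (qf n G) - N G) ` {G. symmetric_mat n G})"
  have bdd: "bdd_above ((\<lambda>G. 2 * E (qf n G) - N G) ` {G. symmetric_mat n G})"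
  proof -
    have "pseudoexp n 4 E" "annihilates n 4 E C"
      using pseudoexp_antimono[OF E] annihilates_antimono[OF ann] d8 by auto
    then show ?thesis using bound by (intro bdd_aboveI[of _ 1]) auto
  qed
  have le\<Phi>: "2 * E (qf n G) - N G \<le> \<Phi>" if "symmetric_mat n G" for G
    unfolding \<Phi>_def using that by (intro cSup_upper[OF _ bdd]) auto
  define Z where "Z = 2 * t * Suc k * (E P - \<beta> - \<gamma>)"
  \<comment> \<open>For each \<open>i\<close>, the conditioned functional is tested with
    \<open>G + t A_i\<close> and \<open>E\<close> itself with \<open>G - t A_i\<close>. In the sum,
    smoothness returns \<open>N G\<close> up to \<open>t * \<gamma>\<close>, and the terms linear in
    \<open>t\<close> measure the change of the value of \<open>A_i\<close>, whose average over
    \<open>i\<close> is at least \<open>E P - \<beta>\<close>.\<close>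
  have *: "2 * (2 * E (qf n G) - N G) + Z \<le> 1 + \<Phi>" if G: "symmetric_mat n G" for G
  proof -
    have symt: "symmetric_mat n (\<lambda>a b. t * A i a b)" "symmetric_mat n (\<lambda>a b. G a b + t * A i a b)"
      "symmetric_mat n (\<lambda>a b. G a b - t * A i a b)" if "i < m" for i
      using symA[OF that] G by (auto simp: symmetric_mat_def)
    define h where "h = E (qf n G)"
    \<comment> \<open>\<open>\<mu>\<close>, \<open>\<alpha>\<close> and \<open>\<pi>\<close> are
      conditioned values multiplied by \<open>\<tau>\<close>, whereas \<open>\<alpha>'\<close> is
      unconditioned.\<close>
    define \<mu> where "\<mu> = (\<lambda>i. E (\<lambda>x. qf n (B i) x * qf n G x))"
    define \<alpha> where "\<alpha> = (\<lambda>i. E (\<lambda>x. qf n (B i) x * qf n (A i) x))"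
    define \<alpha>' where "\<alpha>' = (\<lambda>i. E (qf n (A i)))"
    define \<pi> where "\<pi> = (\<lambda>i. E (\<lambda>x. qf n (B i) x * P x))"
    have pt: "2 * \<mu> i + 2 * h * \<tau> i + 2 * t * (\<alpha> i - \<alpha>' i * \<tau> i) - 2 * (N G + t * \<gamma>) * \<tau> i
        + 2 * t * k * (\<pi> i - (\<beta> + \<gamma>) * \<tau> i) \<le> (1 + \<Phi>) * \<tau> i" (is "?l i \<le> ?r i")
      if i: "i < m" for i
    proof -
      have "2 * (\<mu> i + t * \<alpha> i) - \<tau> i * N (\<lambda>a b. G a b + t * A i a b)
          + 2 * t * k * (\<pi> i - \<tau> i * (\<beta> + \<gamma>)) \<le> \<tau> i"
        using step[OF i symt(2)[OF i]] unfolding Eqf[OF polys_qf] \<mu>_def \<alpha>_def \<pi>_def .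
      moreover have "\<tau> i * (2 * (h - t * \<alpha>' i) - N (\<lambda>a b. G a b - t * A i a b)) \<le> \<tau> i * \<Phi>"
        using le\<Phi>[OF symt(3)[OF i]] Eqf[OF polys_const[of 1], of G "- t" "A i"] \<tau>0[OF i]
        by (intro mult_left_mono) (auto simp: h_def \<alpha>'_def)
      moreover have "\<tau> i * (N (\<lambda>a b. G a b + t * A i a b) + N (\<lambda>a b. G a b - t * A i a b))
          \<le> \<tau> i * (2 * N G + 2 * (t * \<gamma>))"
        using smooth[OF G symt(1)[OF i]] NA[OF i] \<tau>0[OF i] by (intro mult_left_mono) auto
      ultimately show ?thesis by (simp add: algebra_simps)
    qed
    have "(\<Sum>i<m. ?l i) \<le> (\<Sum>i<m. ?r i)"
      using pt by (intro sum_mono) auto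
    moreover have "(\<Sum>i<m. ?l i) = 2 * (\<Sum>i<m. \<mu> i) + 2 * h * (\<Sum>i<m. \<tau> i)
        + 2 * t * ((\<Sum>i<m. \<alpha> i) - (\<Sum>i<m. \<alpha>' i * \<tau> i)) - 2 * (N G + t * \<gamma>) * (\<Sum>i<m. \<tau> i)
        + 2 * t * k * ((\<Sum>i<m. \<pi> i) - (\<beta> + \<gamma>) * (\<Sum>i<m. \<tau> i))"
      by (simp only: sum.distrib sum_subtractf sum_distrib_left[symmetric])
    moreover have "(\<Sum>i<m. ?r i) = 1 + \<Phi>"
      by (simp only: sum_distrib_left[symmetric] total\<tau> mult_1_right)
    moreover have "(\<Sum>i<m. \<mu> i) = h"
      unfolding \<mu>_def h_def by (rule total[OF qf4])
    moreover have "(\<Sum>i<m. \<pi> i) = E P"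
      unfolding \<pi>_def by (rule total[OF pP])
    moreover have "(\<Sum>i<m. \<alpha> i) = E P"
    proof -
      have "(\<lambda>x. qf n (A i) x * qf n (B i) x) \<in> polys n (d + 2)" for i
        by (rule polys_mult[OF polys_qf polys_qf]) (use d8 in simp)
      from pseudoexp_sum[OF E, of "{..<m}" "\<lambda>i x. qf n (A i) x * qf n (B i) x", OF this]
      show ?thesis by (simp add: P_def Ppoly_def[abs_def] \<alpha>_def mult.commute)
    qed
    moreover have "t * (\<Sum>i<m. \<alpha>' i * \<tau> i) \<le> t * \<beta>"
      unfolding \<alpha>'_def \<tau>_def using d8
      by (intro mult_left_mono \<beta> t pseudoexp_antimono[OF E] annihilates_antimono[OF ann]) auto
    ultimately show ?thesis unfolding Z_def h_def[symmetric] total\<tau> by (simp add: algebra_simps)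
  qed
  have "2 * E (qf n G) - N G \<le> (1 + \<Phi> - Z) / 2" if "symmetric_mat n G" for G
    using *[OF that] by simp
  \<comment> \<open>Taking the supremum over \<open>G\<close> puts \<open>\<Phi>\<close> on both
    sides; solving gives \<open>\<Phi> \<le> 1 - Z\<close>.\<close>
  then have "\<Phi> \<le> (1 + \<Phi> - Z) / 2"
    unfolding \<Phi>_def using Suc.prems(3) by (intro cSup_least) auto
  then show ?case using *[OF Suc.prems(3)] le\<Phi>[OF Suc.prems(3)] by (simp add: Z_def P_def)
qed

subsection \<open>Comparison with the norm of the polynomial\<close>

definition bilin :: "nat \<Rightarrow> rmat \<Rightarrow> (nat \<Rightarrow> real) \<Rightarrow> (nat \<Rightarrow> real) \<Rightarrow> real" where
  "bilin n M x y = (\<Sum>i<n. \<Sum>j<n. M i j * x i * y j)"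

lemma bilin_self: "bilin n M x x = qf n M x"
  by (simp add: bilin_def qf_def)

lemma bilin_commute:
  assumes "symmetric_mat n M"
  shows "bilin n M x y = bilin n M y x"
proof -
  have "bilin n M x y = (\<Sum>j<n. \<Sum>i<n. M i j * x i * y j)"
    unfolding bilin_def by (rule sum.swap)
  also have "\<dots> = bilin n M y x"
    unfolding bilin_def using assms by (intro sum.cong refl) (simp add: symmetric_mat_def)
  finally show ?thesis .
qed

lemma bilin_add_left: "bilin n M (\<lambda>i. x i + c * z i) y = bilin n M x y + c * bilin n M z y"
  by (simp add: bilin_def algebra_simps sum.distrib sum_distrib_left)

lemma bilin_sum_left:
  fixes r :: nat
  shows "bilin n M (\<lambda>i. \<Sum>l<r. c l * v l i) y = (\<Sum>l<r. c l * bilin n M (v l) y)"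
proof (induction r)
  case (Suc r)
  then show ?case
    using bilin_add_left[of n M "\<lambda>i. \<Sum>l<r. c l * v l i" "c r" "v r" y] by simp
qed (simp add: bilin_def)

lemma qf_add_scaled:
  assumes "symmetric_mat n M"
  shows "qf n M (\<lambda>i. x i + c * z i) = qf n M x + 2 * c * bilin n M x z + c\<^sup>2 * qf n M z"
  using bilin_commute[OF assms] unfolding bilin_self[symmetric] bilin_add_left
  by (subst (1 2) bilin_commute[OF assms], unfold bilin_add_left)
    (simp add: power2_eq_square algebra_simps)

lemma qf_sum:
  fixes r :: nat
  assumes "symmetric_mat n M"
  shows "qf n M (\<lambda>i. \<Sum>l<r. c l * v l i) = (\<Sum>l<r. \<Sum>m<r. c l * c m * bilin n M (v l) (v m))"
proof -
  have "bilin n M (v l) (\<lambda>i. \<Sum>m<r. c m * v m i) = (\<Sum>m<r. c m * bilin n M (v l) (v m))" for l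
    by (subst (1 2) bilin_commute[OF assms]) (rule bilin_sum_left)
  then show ?thesis
    unfolding bilin_self[symmetric] bilin_sum_left by (simp add: sum_distrib_left mult.assoc)
qed

lemma qf_scaled: "qf n M (\<lambda>i. c * x i) = c\<^sup>2 * qf n M x"
  by (simp add: qf_def sum_distrib_left power2_eq_square mult_ac)

lemma sqnorm_scaled: "sqnorm n (\<lambda>i. c * x i) = c\<^sup>2 * sqnorm n x"
  by (simp add: sqnorm_def sum_distrib_left power_mult_distrib)

lemma sqnorm_nonneg: "0 \<le> sqnorm n x"
  by (simp add: sqnorm_def sum_nonneg)

text \<open>The average of \<open>f (y + \<Sum>l<r. \<xi>\<^sub>l v\<^sub>l)\<close> for independent \<open>\<xi>\<^sub>l\<close> that are \<open>0\<close> with probability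
  \<open>2/3\<close> and \<open>\<plusminus>\<surd>3\<close> with probability \<open>1/6\<close> each: these have the first five moments of a
  standard Gaussian, which is all that a quartic form sees.\<close>

fun gauss_avg :: "(nat \<Rightarrow> nat \<Rightarrow> real) \<Rightarrow> nat \<Rightarrow> ((nat \<Rightarrow> real) \<Rightarrow> real) \<Rightarrow> (nat \<Rightarrow> real) \<Rightarrow> real" where
  "gauss_avg v 0 f y = f y"
| "gauss_avg v (Suc r) f y = 2 / 3 * gauss_avg v r f y
    + 1 / 6 * (gauss_avg v r f (\<lambda>i. y i + sqrt 3 * v r i) + gauss_avg v r f (\<lambda>i. y i + (- sqrt 3) * v r i))"

lemma gauss_avg_nonneg: "(\<And>x. 0 \<le> f x) \<Longrightarrow> 0 \<le> gauss_avg v r f y"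
  by (induction r arbitrary: y) auto

lemma gauss_avg_diff: "gauss_avg v r (\<lambda>x. f x - g x) y = gauss_avg v r f y - gauss_avg v r g y"
proof (induction r arbitrary: y)
  case (Suc r)
  show ?case unfolding gauss_avg.simps Suc.IH by (simp add: algebra_simps)
qed simp

lemma gauss_avg_cmult: "gauss_avg v r (\<lambda>x. c * f x) y = c * gauss_avg v r f y"
proof (induction r arbitrary: y)
  case (Suc r)
  show ?case unfolding gauss_avg.simps Suc.IH by (simp add: algebra_simps)
qed simp

lemma gauss_avg_sum: "gauss_avg v r (\<lambda>x. \<Sum>k<m. f k x) y = (\<Sum>k<m. gauss_avg v r (f k) y)"
  by (induction r arbitrary: y) (simp_all only: gauss_avg.simps sum.distrib sum_distrib_left[symmetric])

text \<open>Wick's formula for a Gaussian vector centred at \<open>y\<close> whose covariance is the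
  sum of the \<open>v_l v_l^T\<close>. Keeping \<open>y\<close> arbitrary lets the induction peel
  off one direction at a time.\<close>

lemma gauss_avg_qf_qf:
  assumes sym: "symmetric_mat n A" "symmetric_mat n B"
  shows "gauss_avg v r (\<lambda>x. qf n A x * qf n B x) y = qf n A y * qf n B y
    + qf n A y * (\<Sum>l<r. qf n B (v l)) + (\<Sum>l<r. qf n A (v l)) * qf n B y
    + 4 * (\<Sum>l<r. bilin n A y (v l) * bilin n B y (v l))
    + (\<Sum>l<r. qf n A (v l)) * (\<Sum>l<r. qf n B (v l))
    + 2 * (\<Sum>l<r. \<Sum>m<r. bilin n A (v l) (v m) * bilin n B (v l) (v m))"
proof (induction r arbitrary: y)
  case (Suc r)
  define w where "w = v r"
  define SA where "SA = (\<Sum>l<r. qf n A (v l))"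
  define SB where "SB = (\<Sum>l<r. qf n B (v l))"
  define D where "D = (\<Sum>l<r. \<Sum>m<r. bilin n A (v l) (v m) * bilin n B (v l) (v m))"
  define T where "T = (\<lambda>x z. \<Sum>l<r. bilin n A x (v l) * bilin n B z (v l))"
  have T: "(\<Sum>l<r. bilin n A (\<lambda>i. y i + c * w i) (v l) * bilin n B (\<lambda>i. y i + c * w i) (v l))
      = T y y + c * (T y w + T w y) + c\<^sup>2 * T w w" for c
    by (simp add: T_def bilin_add_left algebra_simps sum.distrib sum_distrib_left power2_eq_square)
  have IH: "gauss_avg v r (\<lambda>x. qf n A x * qf n B x) (\<lambda>i. y i + c * w i)
      = (qf n A y + 2 * c * bilin n A y w + c\<^sup>2 * qf n A w) * (qf n B y + 2 * c * bilin n B y w + c\<^sup>2 * qf n B w)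
      + (qf n A y + 2 * c * bilin n A y w + c\<^sup>2 * qf n A w) * SB
      + SA * (qf n B y + 2 * c * bilin n B y w + c\<^sup>2 * qf n B w)
      + 4 * (T y y + c * (T y w + T w y) + c\<^sup>2 * T w w) + SA * SB + 2 * D" for c
    unfolding Suc.IH T by (simp only: qf_add_scaled sym SA_def SB_def D_def)
  \<comment> \<open>The new direction \<open>w\<close> contributes a row and a column, equal by
    symmetry, and a diagonal entry.\<close>
  have D': "(\<Sum>l<Suc r. \<Sum>m<Suc r. bilin n A (v l) (v m) * bilin n B (v l) (v m))
      = D + 2 * T w w + qf n A w * qf n B w"
  proof -
    have "(\<Sum>l<r. bilin n A (v l) w * bilin n B (v l) w) = T w w"
      unfolding T_def using sym by (intro sum.cong refl) (metis bilin_commute)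
    then show ?thesis
      by (simp add: sum.distrib D_def w_def[symmetric] bilin_self T_def)
  qed
  have s3: "(sqrt 3)\<^sup>2 = (3::real)" "(- sqrt 3)\<^sup>2 = (3::real)" by simp_all
  have IH0: "gauss_avg v r (\<lambda>x. qf n A x * qf n B x) y
      = qf n A y * qf n B y + qf n A y * SB + SA * qf n B y + 4 * T y y + SA * SB + 2 * D"
    using IH[of 0] by simp
  have sq: "sqrt 3 * sqrt 3 = (3::real)" "sqrt 3 * (sqrt 3 * a) = 3 * a" for a :: real
    by (simp_all flip: mult.assoc)
  have "gauss_avg v (Suc r) (\<lambda>x. qf n A x * qf n B x) y = qf n A y * qf n B y
    + qf n A y * (SB + qf n B w) + (SA + qf n A w) * qf n B y
    + 4 * (T y y + bilin n A y w * bilin n B y w)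
    + (SA + qf n A w) * (SB + qf n B w)
    + 2 * (D + 2 * T w w + qf n A w * qf n B w)"
    unfolding gauss_avg.simps w_def[symmetric] IH IH0 s3
    by (simp add: algebra_simps sq)
  then show ?case
    unfolding D' by (simp add: SA_def SB_def T_def w_def)
qed simp

text \<open>This is the trace of \<open>A \<rho> B \<rho>\<close>, where \<open>\<rho>\<close> is
  the sum of the \<open>v_l v_l^T\<close>. Writing \<open>B\<close> as a sum of squares turns it
  into a sum of values of \<open>A\<close>.\<close>

lemma gram_overlap_nonneg:
  fixes r :: nat
  assumes A: "symmetric_mat n A" "\<And>x. 0 \<le> qf n A x" and B: "symmetric_mat n B" "\<And>x. 0 \<le> qf n B x"
  shows "0 \<le> (\<Sum>l<r. \<Sum>m<r. bilin n A (v l) (v m) * bilin n B (v l) (v m))"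
proof -
  obtain w where w: "\<forall>i<n. \<forall>j<n. B i j = (\<Sum>q<n. w q i * w q j)"
    using psd_gram[OF B] by blast
  define c where "c = (\<lambda>q l. \<Sum>i<n. w q i * v l i)"
  have "bilin n B (v l) (v m) = (\<Sum>q<n. c q l * c q m)" for l m
  proof -
    have "bilin n B (v l) (v m) = (\<Sum>i<n. \<Sum>j<n. \<Sum>q<n. (w q i * v l i) * (w q j * v m j))"
      unfolding bilin_def using w by (intro sum.cong refl) (simp add: sum_distrib_left mult_ac)
    also have "\<dots> = (\<Sum>q<n. \<Sum>i<n. \<Sum>j<n. (w q i * v l i) * (w q j * v m j))"
      by (subst (2) sum.swap) (subst sum.swap, simp)
    finally show ?thesis by (simp add: c_def sum_product)
  qed
  then have "(\<Sum>l<r. \<Sum>m<r. bilin n A (v l) (v m) * bilin n B (v l) (v m))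
      = (\<Sum>l<r. \<Sum>m<r. \<Sum>q<n. c q l * c q m * bilin n A (v l) (v m))"
    by (simp add: sum_distrib_left mult_ac)
  also have "\<dots> = (\<Sum>q<n. \<Sum>l<r. \<Sum>m<r. c q l * c q m * bilin n A (v l) (v m))"
    by (subst (2) sum.swap) (subst sum.swap, simp)
  also have "\<dots> = (\<Sum>q<n. qf n A (\<lambda>i. \<Sum>l<r. c q l * v l i))"
    by (simp add: qf_sum[OF A(1)])
  also have "\<dots> \<ge> 0" by (intro sum_nonneg A(2))
  finally show ?thesis .
qed

text \<open>Coordinate projections: they present the squared norm, and later the squared norms of
  the two blocks, as quadratic forms.\<close>

definition diag_mat :: "nat set \<Rightarrow> rmat" where
  "diag_mat S i j = (if i = j \<and> i \<in> S then 1 else 0)"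

lemma bilin_diag:
  assumes "S \<subseteq> {..<n}"
  shows "bilin n (diag_mat S) x y = (\<Sum>i\<in>S. x i * y i)"
proof -
  have "bilin n (diag_mat S) x y = (\<Sum>i<n. if i \<in> S then x i * y i else 0)"
    unfolding bilin_def
  proof (intro sum.cong refl)
    fix i assume "i \<in> {..<n}"
    have "(\<Sum>j<n. diag_mat S i j * x i * y j) = (\<Sum>j<n. if j = i then (if i \<in> S then x i * y i else 0) else 0)"
      by (intro sum.cong) (auto simp: diag_mat_def)
    then show "(\<Sum>j<n. diag_mat S i j * x i * y j) = (if i \<in> S then x i * y i else 0)"
      using \<open>i \<in> {..<n}\<close> by simp
  qed
  also have "\<dots> = (\<Sum>i\<in>S. x i * y i)"
    using assms by (intro sum.mono_neutral_cong_right) auto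
  finally show ?thesis .
qed

lemma qf_diag: "S \<subseteq> {..<n} \<Longrightarrow> qf n (diag_mat S) = (\<lambda>x. \<Sum>i\<in>S. (x i)\<^sup>2)"
  by (simp add: fun_eq_iff bilin_self[symmetric] bilin_diag power2_eq_square)

lemma qf_id: "qf n (diag_mat {..<n}) = sqnorm n"
  by (simp add: qf_diag sqnorm_def[abs_def])

lemma symmetric_diag: "symmetric_mat n (diag_mat S)"
  by (auto simp: symmetric_mat_def diag_mat_def)

section \<open>Bounds on the polynomial at real points\<close>

locale qf_family =
  fixes n m :: nat and A B :: "nat \<Rightarrow> rmat"
  assumes sym: "k < m \<Longrightarrow> symmetric_mat n (A k)" "k < m \<Longrightarrow> symmetric_mat n (B k)"
    and A: "k < m \<Longrightarrow> 0 \<le> qf n (A k) v" "k < m \<Longrightarrow> qf n (A k) v \<le> sqnorm n v"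
    and B: "k < m \<Longrightarrow> 0 \<le> qf n (B k) v" "(\<Sum>k<m. qf n (B k) v) \<le> sqnorm n v"
begin

lemma Ppoly_nonneg: "0 \<le> Ppoly n m A B x"
  unfolding Ppoly_def using A B by (intro sum_nonneg mult_nonneg_nonneg) auto

text \<open>Ensures that the supremum in \<open>polynorm\<close> is taken over a bounded
  set.\<close>

lemma Ppoly_le_sqnorm: "Ppoly n m A B x \<le> (sqnorm n x)\<^sup>2"
proof -
  have "Ppoly n m A B x \<le> (\<Sum>k<m. sqnorm n x * qf n (B k) x)"
    unfolding Ppoly_def using A B by (intro sum_mono mult_right_mono) auto
  also have "\<dots> \<le> sqnorm n x * sqnorm n x"
    unfolding sum_distrib_left[symmetric] by (intro mult_left_mono B sqnorm_nonneg)
  finally show ?thesis by (simp add: power2_eq_square)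
qed

lemma Ppoly_le_polynorm: "Ppoly n m A B x \<le> polynorm n (Ppoly n m A B) * (sqnorm n x)\<^sup>2"
proof (cases "sqnorm n x = 0")
  case True
  then show ?thesis using Ppoly_le_sqnorm[of x] by simp
next
  case False
  define s where "s = sqnorm n x"
  have s: "0 < s" using False sqnorm_nonneg[of n x] by (simp add: s_def)
  define u where "u = (\<lambda>i. (1 / sqrt s) * x i)"
  have "sqnorm n u = 1"
    unfolding u_def sqnorm_scaled using s by (simp add: power_divide s_def[symmetric])
  moreover have "bdd_above {\<bar>Ppoly n m A B y\<bar> | y. sqnorm n y = 1}"
    using Ppoly_nonneg Ppoly_le_sqnorm by (intro bdd_aboveI[of _ 1]) (auto, metis one_power2)
  ultimately have "\<bar>Ppoly n m A B u\<bar> \<le> polynorm n (Ppoly n m A B)"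
    unfolding polynorm_def by (intro cSup_upper) auto
  moreover have "Ppoly n m A B u = Ppoly n m A B x / s\<^sup>2"
    unfolding Ppoly_def u_def qf_scaled using s
    by (simp add: power_divide sum_divide_distrib power2_eq_square)
  ultimately show ?thesis using s by (simp add: s_def[symmetric] field_simps)
qed

lemma polynorm_nonneg:
  assumes "1 \<le> n"
  shows "0 \<le> polynorm n (Ppoly n m A B)"
proof -
  define e :: "nat \<Rightarrow> real" where "e = (\<lambda>i. if i = 0 then 1 else 0)"
  have "sqnorm n e = 1"
    using assms by (simp add: sqnorm_def e_def power2_eq_square if_distrib[of "\<lambda>a. a * _"] cong: if_cong)
  then show ?thesis using Ppoly_nonneg[of e] Ppoly_le_polynorm[of e] by simp
qed

text \<open>Let \<open>g\<close> be Gaussian with covariance \<open>\<rho>\<close>. The mean of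
  \<open>P(g)\<close> is the left side plus nonnegative overlaps, and it is at most the norm of
  \<open>P\<close> times the mean of \<open>|g|^4\<close>, which is
  \<open>1 + 2 tr(\<rho>^2) <= 3\<close>.\<close>

lemma moments_le_3_polynorm:
  fixes r :: nat
  assumes n: "1 \<le> n" and v: "(\<Sum>l<r. sqnorm n (v l)) = 1"
  shows "(\<Sum>k<m. (\<Sum>l<r. qf n (A k) (v l)) * (\<Sum>l<r. qf n (B k) (v l)))
    \<le> 3 * polynorm n (Ppoly n m A B)"
proof -
  define p where "p = polynorm n (Ppoly n m A B)"
  define z :: "nat \<Rightarrow> real" where "z = (\<lambda>_. 0)"
  have z: "qf n M z = 0" "bilin n M z y = 0" for M y
    by (simp_all add: z_def qf_def bilin_def)
  have id: "gauss_avg v r (\<lambda>x. qf n (diag_mat {..<n}) x * qf n (diag_mat {..<n}) x) z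
      = 1 + 2 * (\<Sum>l<r. \<Sum>m<r. (\<Sum>i<n. v l i * v m i)\<^sup>2)"
    by (subst gauss_avg_qf_qf[OF symmetric_diag symmetric_diag])
      (simp add: z qf_id z(1)[of "diag_mat {..<n}", unfolded qf_id] v bilin_diag power2_eq_square)
  have "0 \<le> gauss_avg v r (\<lambda>x. p * (qf n (diag_mat {..<n}) x * qf n (diag_mat {..<n}) x)
      - (\<Sum>k<m. qf n (A k) x * qf n (B k) x)) z"
    using Ppoly_le_polynorm unfolding qf_id p_def Ppoly_def[abs_def]
    by (intro gauss_avg_nonneg) (simp add: power2_eq_square)
  also have "\<dots> = p * (1 + 2 * (\<Sum>l<r. \<Sum>m<r. (\<Sum>i<n. v l i * v m i)\<^sup>2))
      - (\<Sum>k<m. (\<Sum>l<r. qf n (A k) (v l)) * (\<Sum>l<r. qf n (B k) (v l))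
        + 2 * (\<Sum>l<r. \<Sum>q<r. bilin n (A k) (v l) (v q) * bilin n (B k) (v l) (v q)))"
    unfolding gauss_avg_diff gauss_avg_cmult gauss_avg_sum id
    using sym by (simp add: gauss_avg_qf_qf z)
  finally have "(\<Sum>k<m. (\<Sum>l<r. qf n (A k) (v l)) * (\<Sum>l<r. qf n (B k) (v l))
        + 2 * (\<Sum>l<r. \<Sum>q<r. bilin n (A k) (v l) (v q) * bilin n (B k) (v l) (v q)))
      \<le> p * (1 + 2 * (\<Sum>l<r. \<Sum>m<r. (\<Sum>i<n. v l i * v m i)\<^sup>2))" by simp
  also have "\<dots> \<le> p * (1 + 2 * 1)"
  proof -
    \<comment> \<open>Here \<open>tr(\<rho>^2) <= (tr \<rho>)^2 = 1\<close>.\<close>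
    have "(\<Sum>l<r. \<Sum>m<r. (\<Sum>i<n. v l i * v m i)\<^sup>2) \<le> (\<Sum>l<r. \<Sum>m<r. sqnorm n (v l) * sqnorm n (v m))"
      by (intro sum_mono sum_mult_le_sqnorm)
    also have "\<dots> = 1" by (simp add: sum_product[symmetric] v)
    finally show ?thesis
      unfolding p_def using polynorm_nonneg[OF n] by (intro mult_left_mono) auto
  qed
  finally have "(\<Sum>k<m. (\<Sum>l<r. qf n (A k) (v l)) * (\<Sum>l<r. qf n (B k) (v l))
        + 2 * (\<Sum>l<r. \<Sum>q<r. bilin n (A k) (v l) (v q) * bilin n (B k) (v l) (v q))) \<le> 3 * p"
    by simp
  moreover have "(\<Sum>k<m. (\<Sum>l<r. qf n (A k) (v l)) * (\<Sum>l<r. qf n (B k) (v l)))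
      \<le> (\<Sum>k<m. (\<Sum>l<r. qf n (A k) (v l)) * (\<Sum>l<r. qf n (B k) (v l))
        + 2 * (\<Sum>l<r. \<Sum>q<r. bilin n (A k) (v l) (v q) * bilin n (B k) (v l) (v q)))"
  proof (intro sum_mono)
    fix k assume "k \<in> {..<m}"
    then have k: "k < m" by simp
    show "(\<Sum>l<r. qf n (A k) (v l)) * (\<Sum>l<r. qf n (B k) (v l))
      \<le> (\<Sum>l<r. qf n (A k) (v l)) * (\<Sum>l<r. qf n (B k) (v l))
        + 2 * (\<Sum>l<r. \<Sum>q<r. bilin n (A k) (v l) (v q) * bilin n (B k) (v l) (v q))"
      using gram_overlap_nonneg[OF sym(1)[OF k] A(1)[OF k] sym(2)[OF k] B(1)[OF k]] by simp
  qed
  ultimately show ?thesis by (simp add: p_def)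
qed

text \<open>Glue the first block of \<open>u\<close> to the second block of \<open>w\<close>, each
  rescaled to norm one. The resulting point has squared norm 2, and quartic homogeneity yields the
  factor \<open>2^2 = 4\<close>.\<close>

lemma bipartite_le_polynorm:
  assumes p: "p \<le> n"
    and bA: "\<And>k i j. k < m \<Longrightarrow> i < n \<Longrightarrow> j < n \<Longrightarrow> \<not> (i < p \<and> j < p) \<Longrightarrow> A k i j = 0"
    and bB: "\<And>k i j. k < m \<Longrightarrow> i < n \<Longrightarrow> j < n \<Longrightarrow> \<not> (p \<le> i \<and> p \<le> j) \<Longrightarrow> B k i j = 0"
  shows "(\<Sum>k<m. qf n (A k) u * qf n (B k) w)
    \<le> 4 * polynorm n (Ppoly n m A B) * (\<Sum>i<p. (u i)\<^sup>2) * (\<Sum>i\<in>{p..<n}. (w i)\<^sup>2)"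
proof -
  define Y where "Y = (\<Sum>i<p. (u i)\<^sup>2)"
  define Z where "Z = (\<Sum>i\<in>{p..<n}. (w i)\<^sup>2)"
  define x where "x = (\<lambda>a b i. if i < p then a * u i else b * w i)"
  have xA: "qf n (A k) (x a b) = a\<^sup>2 * qf n (A k) u" if "k < m" for k a b
    unfolding qf_scaled[symmetric] unfolding qf_def x_def using bA[OF that] by (intro sum.cong refl) auto
  have xB: "qf n (B k) (x a b) = b\<^sup>2 * qf n (B k) w" if "k < m" for k a b
    unfolding qf_scaled[symmetric] unfolding qf_def x_def using bB[OF that]
    by (intro sum.cong refl) (auto simp: not_less)
  have xn: "sqnorm n (x a b) = a\<^sup>2 * Y + b\<^sup>2 * Z" for a b
  proof -
    have "sqnorm n (x a b) = (\<Sum>i<p. (x a b i)\<^sup>2) + (\<Sum>i\<in>{p..<n}. (x a b i)\<^sup>2)"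
      unfolding sqnorm_def using p by (simp add: lessThan_atLeast0 sum.atLeastLessThan_concat)
    then show ?thesis
      by (simp add: x_def Y_def Z_def sum_distrib_left power_mult_distrib)
  qed
  have YZ: "0 \<le> Y" "0 \<le> Z" by (auto simp: Y_def Z_def sum_nonneg)
  have "(\<Sum>k<m. qf n (A k) u * qf n (B k) w) \<le> 4 * polynorm n (Ppoly n m A B) * Y * Z"
  proof (cases "Y = 0 \<or> Z = 0")
    \<comment> \<open>If a block vanishes, the upper bound on the forms of that block, taken at the
      point supported there, makes them vanish too.\<close>
    case True
    have "qf n (A k) u * qf n (B k) w = 0" if k: "k < m" for k
      using True
    proof
      assume "Y = 0"
      then have "qf n (A k) u = 0"
        using A(1)[OF k, of u] A(2)[OF k, of "x 1 0"] xA[OF k, of 1 0] xn[of 1 0] by simp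
      then show ?thesis by simp
    next
      assume "Z = 0"
      have "qf n (B k) (x 0 1) \<le> (\<Sum>k<m. qf n (B k) (x 0 1))"
        using k B(1) by (intro member_le_sum) auto
      then have "qf n (B k) w = 0"
        using B(2)[of "x 0 1"] B(1)[OF k, of w] xB[OF k, of 0 1] xn[of 0 1] \<open>Z = 0\<close> by simp
      then show ?thesis by simp
    qed
    then have "(\<Sum>k<m. qf n (A k) u * qf n (B k) w) = 0" by (intro sum.neutral) auto
    then show ?thesis using True by auto
  next
    case False
    with YZ have pos: "0 < Y" "0 < Z" by auto
    define a where "a = 1 / sqrt Y"
    define b where "b = 1 / sqrt Z"
    have ab: "a\<^sup>2 = 1 / Y" "b\<^sup>2 = 1 / Z" using pos by (auto simp: a_def b_def power_divide)
    have "Ppoly n m A B (x a b) \<le> polynorm n (Ppoly n m A B) * (1 + 1)\<^sup>2"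
      using Ppoly_le_polynorm[of "x a b"] pos by (simp add: xn ab)
    moreover have "Ppoly n m A B (x a b) = (\<Sum>k<m. qf n (A k) u * qf n (B k) w) / (Y * Z)"
      unfolding Ppoly_def sum_divide_distrib
      by (intro sum.cong refl) (simp add: xA xB ab)
    ultimately show ?thesis using pos by (simp add: field_simps)
  qed
  then show ?thesis by (simp add: Y_def Z_def)
qed

end

subsection \<open>Choice of the parameters\<close>

text \<open>The exponent \<open>p = 2 ^ Suc s\<close> must make the \<open>p\<close>-th root of
  \<open>n\<close> bounded, yet stay of order \<open>ln n\<close> because it is the smoothness
  constant. The least \<open>s\<close> with \<open>ln n <= p\<close> does both.\<close>

lemma exists_exponent:
  assumes "2 \<le> n"
  obtains s where "real n \<le> 3 ^ 2 ^ Suc s" "2 ^ Suc s \<le> 4 * ln (real n)"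
proof -
  have half: "1 / 2 \<le> ln (2::real)"
    by (rule iffD2[OF ln_ge_iff]) (use exp_half_le2 in simp_all)
  have "ln 2 \<le> ln (real n)" using assms by simp
  with half have ln: "1 / 2 \<le> ln (real n)" by linarith
  define s where "s = (LEAST s. ln (real n) \<le> 2 ^ Suc s)"
  obtain s0 :: nat where "ln (real n) < 2 ^ s0"
    using real_arch_pow[of 2 "ln (real n)"] by auto
  then have "ln (real n) \<le> 2 ^ Suc s0" using ln by simp
  then have s: "ln (real n) \<le> 2 ^ Suc s" unfolding s_def by (rule LeastI)
  have "2 ^ Suc s \<le> 4 * ln (real n)"
  \<comment> \<open>For \<open>s > 0\<close> minimality gives \<open>p < 2 ln n\<close>; for
    \<open>s = 0\<close> the exponent is 2 and \<open>ln n\<close> is at least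
    \<open>1 / 2\<close>.\<close>
  proof (cases s)
    case 0
    then show ?thesis using ln by simp
  next
    case (Suc s')
    then have "\<not> ln (real n) \<le> 2 ^ Suc s'"
      using not_less_Least[of s' "\<lambda>s. ln (real n) \<le> 2 ^ Suc s"] by (simp add: s_def)
    then show ?thesis using ln by (simp add: Suc)
  qed
  moreover have "real n \<le> 3 ^ 2 ^ Suc s"
  proof -
    have "real n = exp (ln (real n))" using assms by simp
    also have "\<dots> \<le> exp (real (2 ^ Suc s) * 1)" using s by simp
    also have "\<dots> = exp 1 ^ 2 ^ Suc s" by (rule exp_of_nat_mult)
    also have "\<dots> \<le> 3 ^ 2 ^ Suc s" using exp_le by (intro power_mono) auto
    finally show ?thesis .
  qed
  ultimately show ?thesis using that by blast
qed

section \<open>Assembling the two bounds\<close>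

context qf_family
begin

text \<open>Reduces both bounds to an estimate \<open>\<beta>\<close> for products of second moments
  at level 4.\<close>

lemma pseudoexp_Ppoly_le:
  assumes n: "2 \<le> n" and \<epsilon>: "0 < \<epsilon>" and d: "200 * ln (real n) / \<epsilon>\<^sup>2 \<le> real d" and \<epsilon>1: "\<epsilon> < 1"
    and C: "(\<lambda>x. sqnorm n x - 1) \<in> C"
    and \<beta>: "\<And>L. pseudoexp n 4 L \<Longrightarrow> annihilates n 4 L C \<Longrightarrow> (\<Sum>i<m. L (qf n (A i)) * L (qf n (B i))) \<le> \<beta>"
    and E: "pseudoexp n d E" "annihilates n d E C"
  shows "E (Ppoly n m A B) \<le> \<beta> + \<epsilon>"
proof -
  obtain s where s: "real n \<le> 3 ^ 2 ^ Suc s" "2 ^ Suc s \<le> 4 * ln (real n)"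
    using exists_exponent[OF n] by blast
  define p :: real where "p = 2 ^ Suc s"
  have p2: "2 \<le> p" unfolding p_def using one_le_power[of "2::real" s] by simp
  \<comment> \<open>The loss per round is \<open>\<gamma> = 9 * p * t\<close>, from smoothness
    constant \<open>p\<close> and Schatten norms at most 3; this \<open>t\<close> makes it
    \<open>\<epsilon> / 2\<close>.\<close>
  define t where "t = \<epsilon> / (18 * p)"
  have t: "0 < t" using \<epsilon> p2 by (simp add: t_def)
  define k where "k = (d - 8) div 2"
  define lam where "lam = ln (real n) / \<epsilon>\<^sup>2"
  have "lam \<ge> ln (real n)"
  proof -
    have "\<epsilon>\<^sup>2 \<le> 1" using \<epsilon> \<epsilon>1 by (simp add: power_le_one)
    moreover have "0 \<le> ln (real n)" using n by simp
    ultimately show ?thesis using \<epsilon> by (simp add: lam_def field_simps mult_left_le)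
  qed
  moreover have "p \<le> 4 * ln (real n)" using s(2) by (simp only: p_def)
  ultimately have lam: "1 / 2 \<le> lam" using p2 by linarith
  have d': "200 * lam \<le> real d" using d by (simp add: lam_def)
  with lam have d100: "100 \<le> d" by linarith
  \<comment> \<open>Nine is the eight levels held back plus one for rounding; \<open>lam\<close>
    being at least \<open>1 / 2\<close> absorbs it.\<close>
  then have "real d - 9 \<le> 2 * real k" unfolding k_def by linarith
  with d' lam have k: "72 * lam \<le> real k" by linarith
  \<comment> \<open>One extra index pairs the remainder form \<open>R\<close> with the zero form:
    the \<open>B'\<close> now sum exactly to the squared norm, and the polynomial is
    unchanged.\<close>
  define A' where "A' = (\<lambda>i. if i < m then A i else (\<lambda>_ _. 0))"
  define R where "R = (\<lambda>i j. diag_mat {..<n} i j - (\<Sum>k<m. B k i j))"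
  define B' where "B' = (\<lambda>i. if i < m then B i else R)"
  have qf0: "qf n (\<lambda>_ _. 0) = (\<lambda>_. 0)" by (simp add: qf_def fun_eq_iff)
  have qfR: "qf n R x = sqnorm n x - (\<Sum>k<m. qf n (B k) x)" for x
  proof -
    have "(\<Sum>k<m. qf n (B k) x) = (\<Sum>i<n. \<Sum>j<n. \<Sum>k<m. B k i j * x i * x j)"
      unfolding qf_def by (subst (2) sum.swap) (subst sum.swap, simp)
    moreover have "qf n R x = qf n (diag_mat {..<n}) x - (\<Sum>i<n. \<Sum>j<n. \<Sum>k<m. B k i j * x i * x j)"
      by (simp add: qf_def R_def left_diff_distrib sum_subtractf sum_distrib_right)
    ultimately show ?thesis by (simp add: qf_id)
  qed
  have symR: "symmetric_mat n R"
    using sym(2) symmetric_diag[of n "{..<n}"] unfolding R_def symmetric_mat_def by auto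
  have P_eq: "Ppoly n (Suc m) A' B' = Ppoly n m A B"
    by (simp add: Ppoly_def fun_eq_iff A'_def B'_def qf0)
  have A'_psd: "0 \<le> qf n (A' i) v" "qf n (A' i) v \<le> sqnorm n v" and A'_sym: "symmetric_mat n (A' i)"
    for i v using A sym(1) sqnorm_nonneg by (auto simp: A'_def qf0 symmetric_mat_def)
  have schatten0: "schatten_sq n s (\<lambda>_ _. 0) \<le> 0"
    using schatten_sq_contraction[OF A'_sym A'_psd, of 3 s 0] s(1) by simp
  \<comment> \<open>The test form is 0, so only the accumulated gain of the \<open>k\<close> rounds
    remains on the left.\<close>
  have "2 * E (qf n (\<lambda>_ _. 0)) - schatten_sq n s (\<lambda>_ _. 0)
      + 2 * t * k * (E (Ppoly n (Suc m) A' B') - \<beta> - 9 * p * t) \<le> 1"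
  proof (rule conditioning_bound[OF C, where N = "schatten_sq n s" and c = p])
    show "symmetric_mat n (A' i)" for i by (rule A'_sym)
    show "symmetric_mat n (B' i)" for i using sym(2) symR by (simp add: B'_def)
    show "0 \<le> qf n (B' i) v" for i v using B by (simp add: B'_def qfR)
    show "(\<Sum>i<Suc m. qf n (B' i) v) = sqnorm n v" for v by (simp add: B'_def qfR)
    show "(\<Sum>i<Suc m. L (qf n (A' i)) * L (qf n (B' i))) \<le> \<beta>"
      if "pseudoexp n 4 L" "annihilates n 4 L C" for L
    proof -
      have "L (\<lambda>_. 0) = 0" using pseudoexp_cmult[OF that(1) polys_const[of 0], of 0] by simp
      then show ?thesis using \<beta>[OF that] by (simp add: A'_def B'_def qf0)
    qed
    show "schatten_sq n s (\<lambda>i j. H i j + Y i j) + schatten_sq n s (\<lambda>i j. H i j - Y i j)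
        \<le> 2 * schatten_sq n s H + 2 * p * schatten_sq n s Y"
      if "symmetric_mat n H" "symmetric_mat n Y" for H Y
    proof -
      have "2 * (p - 1) * schatten_sq n s Y \<le> 2 * p * schatten_sq n s Y"
        using schatten_sq_nonneg[OF that(2)] by (intro mult_right_mono) auto
      then show ?thesis using schatten_sq_smooth[OF that, of s] unfolding p_def by linarith
    qed
    show "p * schatten_sq n s (\<lambda>a b. t * A' i a b) \<le> t * (9 * p * t)" for i
    proof -
      have "schatten_sq n s (\<lambda>a b. t * A' i a b) \<le> t\<^sup>2 * 3\<^sup>2"
        by (rule schatten_sq_contraction[OF A'_sym A'_psd _ s(1)]) simp
      then have "p * schatten_sq n s (\<lambda>a b. t * A' i a b) \<le> p * (t\<^sup>2 * 3\<^sup>2)"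
        using p2 by (intro mult_left_mono) auto
      then show ?thesis by (simp add: power2_eq_square mult_ac)
    qed
    show "2 * L (qf n H) - schatten_sq n s H \<le> 1"
      if "pseudoexp n 4 L" "annihilates n 4 L C" "symmetric_mat n H" for L H
    proof (rule pseudoexp_qf_le_schatten[OF that(1) _ _ that(3)])
      show "L (sqnorm n) = 1"
        using annihilates_sqnorm[OF that(1,2) C polys_const[of 1]] pseudoexp_one[OF that(1)] by simp
    qed simp
    show "pseudoexp n (2 * k + 8) E" "annihilates n (2 * k + 8) E C"
      using d100 by (intro pseudoexp_antimono[OF E(1)] annihilates_antimono[OF E(2)]; simp add: k_def)+
  qed (use t in \<open>auto simp: symmetric_mat_def\<close>)
  moreover have "E (\<lambda>_. 0) = 0" using pseudoexp_cmult[OF E(1) polys_const[of 0], of 0] by simp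
  moreover have "9 * p * t = \<epsilon> / 2" using p2 by (simp add: t_def)
  ultimately have *: "2 * t * k * (E (Ppoly n m A B) - \<beta> - \<epsilon> / 2) \<le> 1"
    using schatten0 by (simp add: P_eq qf0)
  \<comment> \<open>The right side is \<open>k \<epsilon>^2 / (18 p)\<close>, and
    \<open>p <= 4 ln n\<close> explains the \<open>72 = 18 * 4\<close> in the bound on
    \<open>k\<close>.\<close>
  have tk: "1 \<le> 2 * t * k * (\<epsilon> / 2)"
  proof -
    have "18 * p / \<epsilon>\<^sup>2 \<le> 72 * lam"
      using s(2) \<epsilon> by (simp add: lam_def p_def field_simps)
    with k have "18 * p / \<epsilon>\<^sup>2 \<le> real k" by linarith
    then show ?thesis using \<epsilon> p2 by (simp add: t_def field_simps power2_eq_square)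
  qed
  show ?thesis
  proof (rule ccontr)
    assume "\<not> ?thesis"
    then have "\<epsilon> / 2 < E (Ppoly n m A B) - \<beta> - \<epsilon> / 2" by simp
    moreover have "0 < 2 * t * k" using k lam t by simp
    ultimately have "2 * t * k * (\<epsilon> / 2) < 2 * t * k * (E (Ppoly n m A B) - \<beta> - \<epsilon> / 2)"
      by (rule mult_strict_left_mono)
    then show False using * tk by linarith
  qed
qed

lemma pseudoexp_le_3_polynorm:
  assumes n: "1 \<le> n" and \<epsilon>: "0 < \<epsilon>" "\<epsilon> < 1" and d: "4 \<le> d" "200 * ln (real n) / \<epsilon>\<^sup>2 \<le> real d"
    and E: "pseudoexp n d E" "\<forall>Q\<in>polys n (d - 2). E (\<lambda>x. (sqnorm n x - 1) * Q x) = 0"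
  shows "E (Ppoly n m A B) \<le> 3 * polynorm n (Ppoly n m A B) + \<epsilon>"
proof -
  define C where "C = {\<lambda>x. sqnorm n x - 1}"
  have C: "(\<lambda>x. sqnorm n x - 1) \<in> C" by (simp add: C_def)
  have ann: "annihilates n d E C" using E(2) by (simp add: annihilates_def C_def)
  show ?thesis
  \<comment> \<open>For \<open>n = 1\<close> the logarithm vanishes and the choice of exponent
    fails. But then \<open>P\<close> is a multiple of \<open>|X|^4\<close>, which has
    pseudoexpectation 1 by using the constraint twice.\<close>
  proof (cases "n = 1")
    case True
    define a where "a = (\<Sum>k<m. A k 0 0 * B k 0 0)"
    have sq2: "(\<lambda>x. sqnorm n x * sqnorm n x) \<in> polys n d"
      by (rule polys_mult[OF polys_sqnorm polys_sqnorm]) (use d in simp)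
    have P: "Ppoly n m A B = (\<lambda>x. a * (sqnorm n x * sqnorm n x))"
      by (simp add: True fun_eq_iff Ppoly_def qf_def sqnorm_def a_def sum_distrib_left
          power2_eq_square mult_ac)
    have "E (Ppoly n m A B) = a * E (\<lambda>x. sqnorm n x * sqnorm n x)"
      unfolding P by (rule pseudoexp_cmult[OF E(1) sq2])
    also have "E (\<lambda>x. sqnorm n x * sqnorm n x) = E (sqnorm n)"
      using d by (intro annihilates_sqnorm[OF E(1) ann C] polys_mono[OF polys_sqnorm]) auto
    also have "\<dots> = 1"
      using annihilates_sqnorm[OF E(1) ann C polys_const[of 1]] pseudoexp_one[OF E(1)] d by simp
    also have "a * 1 \<le> polynorm n (Ppoly n m A B)"
      using Ppoly_le_polynorm[of "\<lambda>_. 1"] fun_cong[OF P, of "\<lambda>_. 1"] by (simp add: sqnorm_def True)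
    finally show ?thesis using polynorm_nonneg[OF n] \<epsilon> by linarith
  next
    case False
    with n have n2: "2 \<le> n" by simp
    show ?thesis
    proof (rule pseudoexp_Ppoly_le[OF n2 \<epsilon>(1) d(2) \<epsilon>(2) C _ E(1) ann])
      fix L assume L: "pseudoexp n 4 L" "annihilates n 4 L C"
      have one: "L (sqnorm n) = 1"
        using annihilates_sqnorm[OF L C polys_const[of 1]] pseudoexp_one[OF L(1)] by simp
      obtain v where v: "\<And>M. L (qf n M) = (\<Sum>l<n. qf n M (v l))"
        using pseudoexp_qf_gram[OF L(1)] by auto
      show "(\<Sum>i<m. L (qf n (A i)) * L (qf n (B i))) \<le> 3 * polynorm n (Ppoly n m A B)"
        using moments_le_3_polynorm[OF n, where r = n and v = v] one v[of "diag_mat {..<n}"] by (simp add: v qf_id)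
    qed
  qed
qed

lemma pseudoexp_bipartite_le_polynorm:
  assumes n: "1 \<le> n" and \<epsilon>: "0 < \<epsilon>" "\<epsilon> < 1" and d: "4 \<le> d" "200 * ln (real n) / \<epsilon>\<^sup>2 \<le> real d"
    and p: "p \<le> n"
    and bA: "\<And>k i j. k < m \<Longrightarrow> i < n \<Longrightarrow> j < n \<Longrightarrow> \<not> (i < p \<and> j < p) \<Longrightarrow> A k i j = 0"
    and bB: "\<And>k i j. k < m \<Longrightarrow> i < n \<Longrightarrow> j < n \<Longrightarrow> \<not> (p \<le> i \<and> p \<le> j) \<Longrightarrow> B k i j = 0"
    and E: "pseudoexp n d E"
      "\<forall>Q\<in>polys n (d - 2). E (\<lambda>x. ((\<Sum>i<p. (x i)\<^sup>2) - 1/2) * Q x) = 0 \<and>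
                  E (\<lambda>x. ((\<Sum>i\<in>{p..<n}. (x i)\<^sup>2) - 1/2) * Q x) = 0"
  shows "E (Ppoly n m A B) \<le> polynorm n (Ppoly n m A B) + \<epsilon>"
proof -
  define Y where "Y = (\<lambda>x::nat \<Rightarrow> real. \<Sum>i<p. (x i)\<^sup>2)"
  define Z where "Z = (\<lambda>x::nat \<Rightarrow> real. \<Sum>i\<in>{p..<n}. (x i)\<^sup>2)"
  \<comment> \<open>The sphere constraint needed for conditioning is the sum of the two block
    constraints.\<close>
  define C where "C = {\<lambda>x. sqnorm n x - 1, \<lambda>x. Y x - 1/2, \<lambda>x. Z x - 1/2}"
  have C: "(\<lambda>x. sqnorm n x - 1) \<in> C" by (simp add: C_def)
  have "{p..<n} \<subseteq> {..<n}" by auto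
  then have Y: "qf n (diag_mat {..<p}) = Y" and Z: "qf n (diag_mat {p..<n}) = Z"
    using p qf_diag[of "{..<p}" n] qf_diag[of "{p..<n}" n] by (auto simp: Y_def Z_def)
  have pY: "Y \<in> polys n 2" and pZ: "Z \<in> polys n 2"
    by (simp_all only: polys_qf flip: Y Z)
  have YZ: "sqnorm n x = Y x + Z x" for x
    unfolding sqnorm_def Y_def Z_def using p by (simp add: lessThan_atLeast0 sum.atLeastLessThan_concat)
  have half: "E (\<lambda>x. (Y x - 1/2) * Q x) = 0" "E (\<lambda>x. (Z x - 1/2) * Q x) = 0" if "Q \<in> polys n (d - 2)" for Q
    using E(2) that by (auto simp: Y_def Z_def)
  have "E (\<lambda>x. (sqnorm n x - 1) * Q x) = 0" if Q: "Q \<in> polys n (d - 2)" for Q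
  proof -
    have pq: "(\<lambda>x. (F x - 1/2) * Q x) \<in> polys n d" if "F \<in> polys n 2" for F
      by (rule polys_mult[OF polys_diff[OF that polys_const] Q]) (use d in simp)
    have "(\<lambda>x. (sqnorm n x - 1) * Q x) = (\<lambda>x. (Y x - 1/2) * Q x + (Z x - 1/2) * Q x)"
      by (simp add: YZ fun_eq_iff algebra_simps)
    then show ?thesis
      using pseudoexp_add[OF E(1) pq[OF pY] pq[OF pZ]] half[OF Q] by simp
  qed
  then have ann: "annihilates n d E C"
    using half by (auto simp: annihilates_def C_def)
  have marginal: "L F = 1/2" if L: "pseudoexp n 4 L" "annihilates n 4 L C" and F: "F \<in> polys n 2" "(\<lambda>x. F x - 1/2) \<in> C" for L F
  proof -
    have "L (\<lambda>x. F x - 1/2) = L F - L (\<lambda>x. 1/2)"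
      by (intro pseudoexp_diff[OF L(1)] polys_const polys_mono[OF F(1)]) simp
    moreover have "L (\<lambda>x. F x - 1/2) = 0"
      using L(2) F(2) polys_const[of 1 n 2] by (fastforce simp: annihilates_def)
    moreover have "L (\<lambda>x. 1/2) = 1/2"
      using pseudoexp_cmult[OF L(1) polys_const[of 1], of "1/2"] pseudoexp_one[OF L(1)] by simp
    ultimately show ?thesis by simp
  qed
  have YL: "L Y = 1/2" "L Z = 1/2" if "pseudoexp n 4 L" "annihilates n 4 L C" for L
    using marginal[OF that pY] marginal[OF that pZ] by (auto simp: C_def)
  \<comment> \<open>In dimension one some block is empty and would have mass 0 instead of
    \<open>1 / 2\<close>.\<close>
  have n2: "2 \<le> n"
  proof (rule ccontr)
    assume "\<not> 2 \<le> n"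
    with p n have "Y = (\<lambda>_. 0) \<or> Z = (\<lambda>_. 0)" by (cases p) (auto simp: Y_def Z_def)
    moreover have "E (\<lambda>_. 0) = 0"
      using pseudoexp_cmult[OF E(1) polys_const[of 0], of 0] by simp
    ultimately show False
      using YL[OF pseudoexp_antimono[OF E(1) d(1)] annihilates_antimono[OF ann d(1)]] by auto
  qed
  show ?thesis
  proof (rule pseudoexp_Ppoly_le[OF n2 \<epsilon>(1) d(2) \<epsilon>(2) C _ E(1) ann])
    fix L assume L: "pseudoexp n 4 L" "annihilates n 4 L C"
    obtain v where v: "\<And>M. L (qf n M) = (\<Sum>l<n. qf n M (v l))"
      using pseudoexp_qf_gram[OF L(1)] by auto
    have half': "(\<Sum>l<n. Y (v l)) = 1/2" "(\<Sum>l<n. Z (v l)) = 1/2"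
      using YL[OF L] v[of "diag_mat {..<p}"] v[of "diag_mat {p..<n}"] by (simp_all add: Y Z)
    have "(\<Sum>i<m. L (qf n (A i)) * L (qf n (B i)))
        = (\<Sum>i<m. \<Sum>l<n. \<Sum>q<n. qf n (A i) (v l) * qf n (B i) (v q))"
      by (simp add: v sum_product)
    also have "\<dots> = (\<Sum>l<n. \<Sum>q<n. \<Sum>i<m. qf n (A i) (v l) * qf n (B i) (v q))"
      by (subst sum.swap) (subst (2) sum.swap, simp)
    also have "\<dots> \<le> (\<Sum>l<n. \<Sum>q<n. 4 * polynorm n (Ppoly n m A B) * Y (v l) * Z (v q))"
      unfolding Y_def Z_def by (intro sum_mono bipartite_le_polynorm[OF p bA bB])
    also have "\<dots> = 4 * polynorm n (Ppoly n m A B) * ((\<Sum>l<n. Y (v l)) * (\<Sum>l<n. Z (v l)))"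
      unfolding sum_product by (simp add: sum_distrib_left mult.assoc)
    \<comment> \<open>The two block masses \<open>1 / 2\<close> cancel the factor 4.\<close>
    finally show "(\<Sum>i<m. L (qf n (A i)) * L (qf n (B i))) \<le> polynorm n (Ppoly n m A B)"
      by (simp add: half')
  qed
qed

end

theorem theoremC1:
  shows "\<exists>K>0. \<forall>\<epsilon>::real. 0 < \<epsilon> \<and> \<epsilon> < 1 \<longrightarrow>
    (\<forall>n m (A::nat \<Rightarrow> nat \<Rightarrow> nat \<Rightarrow> real) (B::nat \<Rightarrow> nat \<Rightarrow> nat \<Rightarrow> real) d.
      1 \<le> n \<and> 4 \<le> d \<and> real d \<ge> K * ln (real n) / \<epsilon>\<^sup>2 \<and>
      (\<forall>k<m. symmetric_mat n (A k) \<and> symmetric_mat n (B k)) \<and>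
      (\<forall>k<m. \<forall>v. 0 \<le> qf n (A k) v \<and> qf n (A k) v \<le> sqnorm n v) \<and>
      (\<forall>k<m. \<forall>v. 0 \<le> qf n (B k) v) \<and>
      (\<forall>v. (\<Sum>k<m. qf n (B k) v) \<le> sqnorm n v)
      \<longrightarrow>
      (\<forall>E. pseudoexp n d E \<and>
           (\<forall>Q\<in>polys n (d - 2). E (\<lambda>x. (sqnorm n x - 1) * Q x) = 0)
           \<longrightarrow> E (Ppoly n m A B) \<le> 3 * polynorm n (Ppoly n m A B) + \<epsilon>) \<and>
      (\<forall>p. p \<le> n \<and>
           (\<forall>k<m. \<forall>i<n. \<forall>j<n. \<not> (i < p \<and> j < p) \<longrightarrow> A k i j = 0) \<and>
           (\<forall>k<m. \<forall>i<n. \<forall>j<n. \<not> (p \<le> i \<and> p \<le> j) \<longrightarrow> B k i j = 0)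
         \<longrightarrow> (\<forall>E. pseudoexp n d E \<and>
              (\<forall>Q\<in>polys n (d - 2).
                  E (\<lambda>x. ((\<Sum>i<p. (x i)\<^sup>2) - 1/2) * Q x) = 0 \<and>
                  E (\<lambda>x. ((\<Sum>i\<in>{p..<n}. (x i)\<^sup>2) - 1/2) * Q x) = 0)
              \<longrightarrow> E (Ppoly n m A B) \<le> polynorm n (Ppoly n m A B) + \<epsilon>)))"
\<comment> \<open>The constant covers \<open>72 * lam\<close> rounds of two levels each and the
  levels held back at the end.\<close>
proof (rule exI[of _ 200], intro conjI allI impI; (elim conjE)?)
  fix \<epsilon> :: real and n m d :: nat and A B :: "nat \<Rightarrow> nat \<Rightarrow> nat \<Rightarrow> real" and E
  assume \<epsilon>: "0 < \<epsilon>" "\<epsilon> < 1" and n: "1 \<le> n" and d: "4 \<le> d" "200 * ln (real n) / \<epsilon>\<^sup>2 \<le> real d"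
    and AB: "\<forall>k<m. symmetric_mat n (A k) \<and> symmetric_mat n (B k)"
      "\<forall>k<m. \<forall>v. 0 \<le> qf n (A k) v \<and> qf n (A k) v \<le> sqnorm n v"
      "\<forall>k<m. \<forall>v. 0 \<le> qf n (B k) v"
      "\<forall>v. (\<Sum>k<m. qf n (B k) v) \<le> sqnorm n v"
    and E: "pseudoexp n d E"
  interpret qf_family n m A B using AB by unfold_locales auto
  show "E (Ppoly n m A B) \<le> 3 * polynorm n (Ppoly n m A B) + \<epsilon>"
    if "\<forall>Q\<in>polys n (d - 2). E (\<lambda>x. (sqnorm n x - 1) * Q x) = 0"
    using n \<epsilon> d E that by (rule pseudoexp_le_3_polynorm)
  show "E (Ppoly n m A B) \<le> polynorm n (Ppoly n m A B) + \<epsilon>"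
    if "p \<le> n" "\<forall>k<m. \<forall>i<n. \<forall>j<n. \<not> (i < p \<and> j < p) \<longrightarrow> A k i j = 0"
      "\<forall>k<m. \<forall>i<n. \<forall>j<n. \<not> (p \<le> i \<and> p \<le> j) \<longrightarrow> B k i j = 0"
      "\<forall>Q\<in>polys n (d - 2). E (\<lambda>x. ((\<Sum>i<p. (x i)\<^sup>2) - 1/2) * Q x) = 0 \<and>
        E (\<lambda>x. ((\<Sum>i\<in>{p..<n}. (x i)\<^sup>2) - 1/2) * Q x) = 0" for p
    using that by (intro pseudoexp_bipartite_le_polynorm[OF n \<epsilon> d that(1) _ _ E]) auto
qed simp

end
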